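(* Let $(n_k)_{k\ge 0}$ be a strictly monotone increasing sequence of integers, let $G$ be a compact, locally connected Abelian group with Haar measure $m$, and let $f: G \to \mathbb{R}$ be a measurable function. If $m(\Gamma_{f,b})>0$, then $f \in L^1(G)$.
   Context: $G$ is a compact Abelian topological group, written additively, and $m$ is its Haar measure, normalized so that $m(G)=1$; measurability, "a.e." and $L^1(G)$ refer to $m$. For a measurable $f:G\to\mathbb{R}$ and the given sequence $(n_k)$, define $$\Gamma_{f,b}=\Big\{\alpha \in G: \limsup_{k \to \infty}\frac{|f(x+n_k \alpha)|}{k} < \infty \text{ for } m\text{-a.e. } x\in G\Big\},$$ where the limsup is over $k\ge 1$. *)

theory Defs
  imports "HOL-Analysis.Analysis"
begin

text \<open>The integer multiple \<open>k \<alpha>\<close> in an additively written abelian group; the library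
  only provides it in rings (\<open>of_int k * \<alpha>\<close>) or for carrier-based groups.\<close>

definition int_mult :: "int \<Rightarrow> 'a::ab_group_add \<Rightarrow> 'a" where
  "int_mult k a = (if 0 \<le> k then (\<Sum>i<nat k. a) else - (\<Sum>i<nat (- k). a))"

lemma int_mult_ring: "int_mult k a = of_int k * (a :: 'a::ring_1)"
  by (simp add: int_mult_def)

text \<open>The normalized Haar measure, as a Borel measure. The regularity conditions are part of the
  notion: without metrizability they do not follow from invariance. Completeness is
  not included: measurability, ``a.e.'' and integrability are to be taken
  with respect to \<open>completion M\<close>.\<close>

definition normalized_haar_measure :: "'a::{topological_ab_group_add,t2_space} measure \<Rightarrow> bool" where
  "normalized_haar_measure M \<longleftrightarrow>
     sets M = sets borel \<and>
     emeasure M UNIV = 1 \<and>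
     (\<forall>A\<in>sets borel. \<forall>a. emeasure M ((\<lambda>x. a + x) ` A) = emeasure M A) \<and>
     (\<forall>A\<in>sets borel. emeasure M A = (INF U\<in>{U. open U \<and> A \<subseteq> U}. emeasure M U)) \<and>
     (\<forall>U. open U \<longrightarrow> emeasure M U = (SUP K\<in>{K. compact K \<and> K \<subseteq> U}. emeasure M K))"

text \<open>The set \<open>\<Gamma>\<^sub>f\<^sub>,\<^sub>b\<close>. The term with \<open>k = 0\<close> (where the quotient is \<open>0\<close> by convention)
  does not influence the limes superior.\<close>

definition Gamma_b ::
  "'a::{topological_ab_group_add,t2_space} measure \<Rightarrow> (nat \<Rightarrow> int) \<Rightarrow> ('a \<Rightarrow> real) \<Rightarrow> 'a set" where
  "Gamma_b m n f =
     {\<alpha>. AE x in m. limsup (\<lambda>k. ereal (\<bar>f (x + int_mult (n k) \<alpha>)\<bar> / real k)) < \<infinity>}"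

end

theory Submission
  imports Defs "HOL-Probability.Probability"
begin

text \<open>Let \<open>H\<close> be the connected component of \<open>0\<close>; by local connectedness it is open, so it has finitely
  many cosets. A compact connected abelian group is divisible, hence multiplication by a nonzero
  integer preserves the normalized Haar measure \<open>\<nu>\<close> of \<open>H\<close>. It follows that for \<open>k \<noteq> l\<close> the points
  \<open>x + n\<^sub>k \<gamma>\<close> and \<open>x + n\<^sub>l \<gamma>\<close> are independent and uniformly distributed when \<open>(\<gamma>, x)\<close> is
  distributed according to \<open>\<nu> \<otimes> \<nu>\<close>. If \<open>f\<close> is not integrable, then the measures of the sets
  \<open>{\<bar>f\<bar> > C k}\<close> have a divergent sum for every \<open>C\<close>, and the second Borel--Cantelli lemma for
  pairwise independent events shows that \<open>\<bar>f (x + n\<^sub>k (\<beta> + \<gamma>))\<bar> > C k\<close> infinitely often, for almost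
  every \<open>\<gamma> \<in> H\<close> and almost every \<open>x\<close> in a suitable coset.\<close>

section \<open>Fourier analysis on the grid of residue vectors\<close>

text \<open>The classical proof of divisibility takes a nontrivial character of the compact group
  H/nH, whose existence needs duality or representation theory. Here only the explicit characters of
  (Z/n)^d occur. What makes this possible is a bound that involves n and the variation along each
  generator, but not the number d of generators: all constants are fixed first, and then generators
  may be taken as close to 0, and as many, as required.

  Two further obstacles shape the measure theory. Without a countable base, sums need not be
  measurable from the product of the Borel algebras to the Borel algebra, so Borel sets are
  exchanged, up to null sets, for Baire sets. And for \<alpha> = \<beta> + \<gamma> the translation
  by \<open>n k\<close> times \<beta> carries a coset of H to another one that changes with k. The
  divergence of the tail sums must therefore be located along the itinerary of one starting coset,
  and for all C simultaneously; finiteness of the set of cosets and monotonicity in C achieve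
  this.\<close>

locale finite_characters =
  fixes I :: "'i set" and J :: "'j set" and add :: "'i \<Rightarrow> 'i \<Rightarrow> 'i"
    and chr :: "'j \<Rightarrow> 'i \<Rightarrow> complex" and \<zeta> :: 'j
  assumes fin_I: "finite I" and fin_J: "finite J"
    and add_bij: "y \<in> I \<Longrightarrow> bij_betw (\<lambda>x. add x y) I I"
    and char_add: "\<xi> \<in> J \<Longrightarrow> x \<in> I \<Longrightarrow> y \<in> I \<Longrightarrow> chr \<xi> (add x y) = chr \<xi> x * chr \<xi> y"
    and norm_char: "\<xi> \<in> J \<Longrightarrow> x \<in> I \<Longrightarrow> norm (chr \<xi> x) = 1"
    and orthogonal: "x \<in> I \<Longrightarrow> y \<in> I \<Longrightarrow>
      (\<Sum>\<xi>\<in>J. chr \<xi> x * cnj (chr \<xi> y)) = (if x = y then of_nat (card I) else 0)"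
    and trivial_in: "\<zeta> \<in> J" and trivial_char: "x \<in> I \<Longrightarrow> chr \<zeta> x = 1"
begin

definition transform :: "('i \<Rightarrow> real) \<Rightarrow> 'j \<Rightarrow> complex" where
  "transform F \<xi> = (\<Sum>x\<in>I. of_real (F x) * chr \<xi> x)"

text \<open>A nonzero value at x means that x moves some point of the support of F to a point of the
  support; this is how differences of support points are detected.\<close>

definition autocorr :: "('i \<Rightarrow> real) \<Rightarrow> 'i \<Rightarrow> real" where
  "autocorr F x = (\<Sum>y\<in>I. F (add x y) * F y)"

lemma sum_shift: "y \<in> I \<Longrightarrow> (\<Sum>x\<in>I. h (add x y)) = (\<Sum>x\<in>I. h x)"
  by (rule sum.reindex_bij_betw[OF add_bij])

lemma add_closed: "x \<in> I \<Longrightarrow> y \<in> I \<Longrightarrow> add x y \<in> I"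
  using add_bij bij_betwE by blast

lemma parseval:
  fixes F :: "'i \<Rightarrow> real"
  shows "(\<Sum>\<xi>\<in>J. (norm (transform F \<xi>))\<^sup>2) = card I * (\<Sum>x\<in>I. (F x)\<^sup>2)"
proof -
  have "complex_of_real (\<Sum>\<xi>\<in>J. (norm (transform F \<xi>))\<^sup>2)
      = (\<Sum>\<xi>\<in>J. transform F \<xi> * cnj (transform F \<xi>))"
    by (simp add: complex_norm_square flip: of_real_power)
  also have "\<dots> = (\<Sum>\<xi>\<in>J. \<Sum>x\<in>I. \<Sum>y\<in>I. of_real (F x * F y) * (chr \<xi> x * cnj (chr \<xi> y)))"
    unfolding transform_def cnj_sum sum_product by (simp add: mult_ac)
  also have "\<dots> = (\<Sum>x\<in>I. \<Sum>y\<in>I. \<Sum>\<xi>\<in>J. of_real (F x * F y) * (chr \<xi> x * cnj (chr \<xi> y)))"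
    by (subst sum.swap, rule sum.cong[OF refl], rule sum.swap)
  also have "\<dots> = (\<Sum>x\<in>I. \<Sum>y\<in>I. of_real (F x * F y) * (if x = y then of_nat (card I) else 0))"
    unfolding sum_distrib_left[symmetric] using orthogonal by (intro sum.cong refl) auto
  also have "\<dots> = (\<Sum>x\<in>I. of_real (F x * F x) * of_nat (card I))"
    using fin_I by (simp add: if_distrib sum.delta cong: if_cong)
  also have "\<dots> = complex_of_real (card I * (\<Sum>x\<in>I. (F x)\<^sup>2))"
    by (simp add: power2_eq_square sum_distrib_left mult_ac)
  finally show ?thesis by (simp only: of_real_eq_iff)
qed

text \<open>Shifting x by y in the inner sum separates the variables; the remaining factor is the
  inverse of \<open>chr \<xi> y\<close>, which is its conjugate because characters have norm
  1.\<close>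

lemma transform_autocorr:
  fixes F :: "'i \<Rightarrow> real"
  assumes "\<xi> \<in> J"
  shows "transform (autocorr F) \<xi> = transform F \<xi> * cnj (transform F \<xi>)"
proof -
  have inv: "cnj (chr \<xi> y) * chr \<xi> y = 1" if "y \<in> I" for y
    using norm_char[OF assms that] complex_norm_square[of "chr \<xi> y"] by (simp add: mult.commute)
  have "transform (autocorr F) \<xi> = (\<Sum>x\<in>I. \<Sum>y\<in>I. of_real (F (add x y) * F y) * chr \<xi> x)"
    by (simp add: transform_def autocorr_def sum_distrib_right)
  also have "\<dots> = (\<Sum>y\<in>I. \<Sum>x\<in>I. of_real (F (add x y) * F y) * chr \<xi> x)"
    by (rule sum.swap)
  also have "\<dots> = (\<Sum>y\<in>I. \<Sum>x\<in>I. (of_real (F y) * cnj (chr \<xi> y)) * (of_real (F (add x y)) * chr \<xi> (add x y)))"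
  proof (intro sum.cong refl)
    fix x y assume xy: "x \<in> I" "y \<in> I"
    show "of_real (F (add x y) * F y) * chr \<xi> x
      = (of_real (F y) * cnj (chr \<xi> y)) * (of_real (F (add x y)) * chr \<xi> (add x y))"
      using inv[OF xy(2)] by (simp add: char_add[OF assms xy] mult_ac)
  qed
  also have "\<dots> = (\<Sum>y\<in>I. (of_real (F y) * cnj (chr \<xi> y)) * (\<Sum>x\<in>I. of_real (F x) * chr \<xi> x))"
    unfolding sum_distrib_left[symmetric]
    by (intro sum.cong refl arg_cong2[where f="(*)"] sum_shift)
  also have "\<dots> = transform F \<xi> * cnj (transform F \<xi>)"
    unfolding transform_def cnj_sum complex_cnj_mult complex_cnj_complex_of_real
      sum_distrib_right[symmetric] by (rule mult.commute)
  finally show ?thesis .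
qed

lemma transform_trivial: "transform (F :: 'i \<Rightarrow> real) \<zeta> = of_real (\<Sum>x\<in>I. F x)"
  by (simp add: transform_def trivial_char)

lemma sum_autocorr:
  fixes F :: "'i \<Rightarrow> real"
  shows "(\<Sum>x\<in>I. autocorr F x) = (\<Sum>x\<in>I. F x)\<^sup>2"
proof -
  have "complex_of_real (\<Sum>x\<in>I. autocorr F x) = of_real ((\<Sum>x\<in>I. F x)\<^sup>2)"
    using transform_autocorr[OF trivial_in, of F]
    by (simp only: transform_trivial complex_cnj_complex_of_real power2_eq_square of_real_mult)
  then show ?thesis by (simp only: of_real_eq_iff)
qed

text \<open>A function without large nontrivial Fourier coefficients has an almost constant
  autocorrelation.\<close>

lemma autocorr_square_le:
  fixes F :: "'i \<Rightarrow> real" and r :: real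
  assumes small: "\<And>\<xi>. \<xi> \<in> J \<Longrightarrow> \<xi> \<noteq> \<zeta> \<Longrightarrow> norm (transform F \<xi>) \<le> r"
    and r: "0 \<le> r"
  shows "card I * (\<Sum>x\<in>I. (autocorr F x)\<^sup>2) \<le> (\<Sum>x\<in>I. F x) ^ 4 + r\<^sup>2 * (card I * (\<Sum>x\<in>I. (F x)\<^sup>2))"
proof -
  have "card I * (\<Sum>x\<in>I. (autocorr F x)\<^sup>2) = (\<Sum>\<xi>\<in>J. (norm (transform (autocorr F) \<xi>))\<^sup>2)"
    by (simp add: parseval)
  also have "\<dots> = (\<Sum>\<xi>\<in>J. (norm (transform F \<xi>)) ^ 4)"
    by (intro sum.cong refl) (simp add: transform_autocorr norm_mult power_mult_distrib flip: power_add)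
  also have "\<dots> = (norm (transform F \<zeta>)) ^ 4 + (\<Sum>\<xi>\<in>J - {\<zeta>}. (norm (transform F \<xi>)) ^ 4)"
    using fin_J trivial_in by (simp add: sum.remove)
  also have "(\<Sum>\<xi>\<in>J - {\<zeta>}. (norm (transform F \<xi>)) ^ 4) \<le> (\<Sum>\<xi>\<in>J - {\<zeta>}. r\<^sup>2 * (norm (transform F \<xi>))\<^sup>2)"
  proof (intro sum_mono)
    fix \<xi> assume "\<xi> \<in> J - {\<zeta>}"
    then have "(norm (transform F \<xi>))\<^sup>2 \<le> r\<^sup>2" using small by (intro power_mono) auto
    then have "(norm (transform F \<xi>))\<^sup>2 * (norm (transform F \<xi>))\<^sup>2 \<le> r\<^sup>2 * (norm (transform F \<xi>))\<^sup>2"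
      by (intro mult_right_mono) auto
    then show "(norm (transform F \<xi>)) ^ 4 \<le> r\<^sup>2 * (norm (transform F \<xi>))\<^sup>2"
      by (simp flip: power_add)
  qed
  also have "\<dots> \<le> (\<Sum>\<xi>\<in>J. r\<^sup>2 * (norm (transform F \<xi>))\<^sup>2)"
    by (intro sum_mono2) (use fin_J in auto)
  also have "\<dots> = r\<^sup>2 * (card I * (\<Sum>x\<in>I. (F x)\<^sup>2))"
    by (simp add: parseval flip: sum_distrib_left)
  also have "(norm (transform F \<zeta>)) ^ 4 = (\<Sum>x\<in>I. F x) ^ 4"
    unfolding transform_trivial norm_of_real by (rule power_even_abs) simp
  finally show ?thesis by simp
qed

text \<open>By \<open>disj\<close> the autocorrelation lives where \<open>F (add x b)\<close>
  vanishes, a set that misses a proportion c of the group in the weighted sense. Cauchy-Schwarz then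
  gains a factor 1 - c over the nearly constant case of \<open>autocorr_square_le\<close>: c^4 \<le>
  (c^4 + \<delta>^2) (1 - c). The terms c^4 cancel and leave c^5.\<close>

lemma mean_power_le:
  fixes F :: "'i \<Rightarrow> real" and \<delta> c :: real
  assumes small: "\<And>\<xi>. \<xi> \<in> J \<Longrightarrow> \<xi> \<noteq> \<zeta> \<Longrightarrow> norm (transform F \<xi>) \<le> \<delta> * card I"
    and \<delta>: "0 \<le> \<delta>"
    and range: "\<And>x. x \<in> I \<Longrightarrow> 0 \<le> F x \<and> F x \<le> 1"
    and b: "b \<in> I"
    and disj: "\<And>x y. x \<in> I \<Longrightarrow> y \<in> I \<Longrightarrow> F (add x y) = 0 \<or> F y = 0 \<or> F (add x b) = 0"
    and c: "c = (\<Sum>x\<in>I. F x) / card I"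
  shows "c ^ 5 \<le> \<delta>\<^sup>2"
proof (cases "c = 0")
  case True then show ?thesis by simp
next
  case False
  define N where "N = real (card I)"
  have N: "N > 0" using b fin_I unfolding N_def by (auto simp: card_gt_0_iff)
  have cN: "(\<Sum>x\<in>I. F x) = c * N" using c N by (simp add: N_def)
  have "0 \<le> c" unfolding c using range by (intro divide_nonneg_nonneg sum_nonneg) auto
  then have c0: "0 < c" using False by simp
  have "(\<Sum>x\<in>I. F x) \<le> (\<Sum>x\<in>I. 1)" using range by (intro sum_mono) auto
  then have "c * N \<le> N" unfolding cN by (simp add: N_def)
  then have c1: "c \<le> 1" using N by simp
  \<comment> \<open>The factor is 1 where \<open>F (add x b)\<close> is 0, and elsewhere the
    autocorrelation is 0 anyway. Summed after Cauchy-Schwarz, this weight yields N (1 - c).\<close>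
  have vanish: "autocorr F x = autocorr F x * (1 - F (add x b))" if "x \<in> I" for x
  proof (cases "F (add x b) = 0")
    case False
    then have "autocorr F x = 0" unfolding autocorr_def using disj[OF that] by (intro sum.neutral) auto
    then show ?thesis by simp
  qed simp
  have "c ^ 4 * N ^ 4 = (\<Sum>x\<in>I. autocorr F x)\<^sup>2"
    unfolding sum_autocorr cN by (simp add: power_mult_distrib flip: power_mult)
  also have "\<dots> = (\<Sum>x\<in>I. autocorr F x * (1 - F (add x b)))\<^sup>2"
    by (intro arg_cong[where f = "\<lambda>t. t\<^sup>2"] sum.cong refl vanish)
  also have "\<dots> \<le> (\<Sum>x\<in>I. (autocorr F x)\<^sup>2) * (\<Sum>x\<in>I. (1 - F (add x b))\<^sup>2)"
    by (rule Cauchy_Schwarz_ineq_sum)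
  also have "\<dots> \<le> (\<Sum>x\<in>I. (autocorr F x)\<^sup>2) * (\<Sum>x\<in>I. 1 - F (add x b))"
  proof (intro mult_left_mono sum_mono sum_nonneg)
    fix x assume "x \<in> I"
    then have "0 \<le> F (add x b) \<and> F (add x b) \<le> 1" using range add_closed b by auto
    then show "(1 - F (add x b))\<^sup>2 \<le> 1 - F (add x b)" by (intro power2_le_iff_abs_le[THEN iffD2] | simp add: power2_eq_square mult_left_le)+
  qed auto
  also have "(\<Sum>x\<in>I. 1 - F (add x b)) = N * (1 - c)"
    unfolding sum_subtractf sum_shift[OF b] cN by (simp add: N_def algebra_simps)
  finally have "c ^ 4 * N ^ 4 \<le> (N * (\<Sum>x\<in>I. (autocorr F x)\<^sup>2)) * (1 - c)" by (simp add: mult_ac)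
  also have "\<dots> \<le> ((c * N) ^ 4 + (\<delta> * N)\<^sup>2 * (N * (\<Sum>x\<in>I. (F x)\<^sup>2))) * (1 - c)"
    using autocorr_square_le[OF small] \<delta> N c1 cN by (intro mult_right_mono) (auto simp: N_def)
  also have "\<dots> \<le> ((c * N) ^ 4 + (\<delta> * N)\<^sup>2 * (N * N)) * (1 - c)"
  proof -
    have "(\<Sum>x\<in>I. (F x)\<^sup>2) \<le> (\<Sum>x\<in>I. 1)" using range by (intro sum_mono) (auto simp: power_le_one)
    then show ?thesis using N c1 by (intro mult_right_mono add_left_mono mult_left_mono) (auto simp: N_def)
  qed
  also have "\<dots> = ((c ^ 4 + \<delta>\<^sup>2) * (1 - c)) * N ^ 4" by (simp add: power_mult_distrib algebra_simps power2_eq_square power4_eq_xxxx)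
  finally have "c ^ 4 \<le> (c ^ 4 + \<delta>\<^sup>2) * (1 - c)" using N by simp
  then have "c ^ 5 \<le> \<delta>\<^sup>2 * (1 - c)" by (simp add: algebra_simps eval_nat_numeral)
  also have "\<dots> \<le> \<delta>\<^sup>2" using c0 c1 by (simp add: mult_left_le)
  finally show ?thesis .
qed

end

section \<open>The finite group (Z/n)^d and its characters\<close>

definition grid :: "nat \<Rightarrow> nat \<Rightarrow> (nat \<Rightarrow> nat) set" where
  "grid n d = PiE {..<d} (\<lambda>_. {..<n})"

definition grid_add :: "nat \<Rightarrow> nat \<Rightarrow> (nat \<Rightarrow> nat) \<Rightarrow> (nat \<Rightarrow> nat) \<Rightarrow> nat \<Rightarrow> nat" where
  "grid_add n d x y = (\<lambda>i\<in>{..<d}. (x i + y i) mod n)"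

definition grid_unit :: "nat \<Rightarrow> nat \<Rightarrow> nat \<Rightarrow> nat" where
  "grid_unit d i = (\<lambda>j\<in>{..<d}. if j = i then 1 else 0)"

definition unity_root :: "nat \<Rightarrow> complex" where
  "unity_root n = cis (2 * pi / n)"

text \<open>The character exp(2 pi i (\<xi> . x) / n). The group is self-dual, so the grid also
  serves as index set of its characters.\<close>

definition grid_char :: "nat \<Rightarrow> nat \<Rightarrow> (nat \<Rightarrow> nat) \<Rightarrow> (nat \<Rightarrow> nat) \<Rightarrow> complex" where
  "grid_char n d \<xi> x = (\<Prod>i<d. unity_root n ^ (\<xi> i * x i))"

lemma norm_unity_root [simp]: "norm (unity_root n) = 1"
  by (simp add: unity_root_def)

lemma unity_root_power_n: "n > 0 \<Longrightarrow> unity_root n ^ n = 1"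
  by (simp add: unity_root_def Complex.DeMoivre)

lemma unity_root_power_power [simp]: "n > 0 \<Longrightarrow> (unity_root n ^ a) ^ n = 1"
  by (metis mult.commute power_mult power_one unity_root_power_n)

lemma unity_root_power_mod:
  assumes "n > 0"
  shows "unity_root n ^ (k * (a mod n)) = unity_root n ^ (k * a)"
proof -
  have "unity_root n ^ a = unity_root n ^ (n * (a div n) + a mod n)" by simp
  also have "\<dots> = unity_root n ^ (a mod n)"
    unfolding power_add power_mult using assms by (simp add: unity_root_power_n)
  finally show ?thesis by (metis power_mult mult.commute)
qed

lemma unity_root_power_inj: "n > 0 \<Longrightarrow> inj_on (\<lambda>k. unity_root n ^ k) {..<n}"
  using bij_betw_imp_inj_on[OF Complex.bij_betw_roots_unity, of n]
  by (simp add: unity_root_def Complex.DeMoivre mult_ac)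

text \<open>A geometric sum whose ratio w is an n-th root of unity, equal to 1 only if a =
  b.\<close>

lemma unity_root_orthogonal:
  assumes "n > 0" "a < n" "b < n"
  shows "(\<Sum>k<n. unity_root n ^ (k * a) * cnj (unity_root n ^ (k * b))) = (if a = b then of_nat n else 0)"
proof -
  define w where "w = unity_root n ^ a * cnj (unity_root n ^ b)"
  have norm1: "unity_root n ^ b * cnj (unity_root n ^ b) = 1"
    using complex_norm_square[of "unity_root n ^ b"] by (simp add: norm_power)
  have "(\<Sum>k<n. unity_root n ^ (k * a) * cnj (unity_root n ^ (k * b))) = (\<Sum>k<n. w ^ k)"
    by (intro sum.cong refl) (simp add: w_def power_mult_distrib mult.commute flip: power_mult)
  moreover have "(\<Sum>k<n. w ^ k) = 0" if "a \<noteq> b"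
  proof -
    have "w \<noteq> 1"
    proof
      assume "w = 1"
      then have "unity_root n ^ a * (unity_root n ^ b * cnj (unity_root n ^ b)) = unity_root n ^ b"
        by (simp add: w_def mult_ac)
      then have "unity_root n ^ a = unity_root n ^ b" unfolding norm1 by simp
      then show False using unity_root_power_inj[OF assms(1)] assms that by (auto dest: inj_onD)
    qed
    moreover have "w ^ n = 1"
      using assms(1) by (simp add: w_def power_mult_distrib flip: complex_cnj_power)
    ultimately show ?thesis by (simp add: sum_gp_strict)
  qed
  moreover have "w = 1" if "a = b" using norm1 that by (simp add: w_def)
  ultimately show ?thesis by simp
qed

lemma grid_characters:
  assumes n: "n \<ge> 2"
  shows "finite_characters (grid n d) (grid n d) (grid_add n d) (grid_char n d) (\<lambda>i\<in>{..<d}. 0)"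
proof
  show fin: "finite (grid n d)"
    unfolding grid_def by (auto intro: finite_PiE)
  fix y assume y: "y \<in> grid n d"
  show "bij_betw (\<lambda>x. grid_add n d x y) (grid n d) (grid n d)"
  proof -
    have sub: "(\<lambda>x. grid_add n d x y) ` grid n d \<subseteq> grid n d"
      using n by (intro image_subsetI) (simp add: grid_def grid_add_def restrict_PiE_iff)
    have "inj_on (\<lambda>x. grid_add n d x y) (grid n d)"
    proof (rule inj_onI)
      fix x x' assume xx: "x \<in> grid n d" "x' \<in> grid n d" and eq: "grid_add n d x y = grid_add n d x' y"
      show "x = x'"
      proof (rule PiE_ext[OF xx[unfolded grid_def]])
        fix i assume i: "i \<in> {..<d}"
        have "(x i + y i) mod n = (x' i + y i) mod n"
          using fun_cong[OF eq, of i] i by (simp add: grid_add_def)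
        \<comment> \<open>Adding n y - y, a natural number, amounts to subtracting y modulo
          n.\<close>
        then have "((x i + y i) + (n * y i - y i)) mod n = ((x' i + y i) + (n * y i - y i)) mod n"
          by (metis mod_add_left_eq)
        moreover have "y i \<le> n * y i" using n by simp
        ultimately have "x i mod n = x' i mod n" by simp
        then show "x i = x' i" using xx i by (simp add: grid_def PiE_iff)
      qed
    qed
    then show ?thesis using endo_inj_surj[OF fin sub] by (simp add: bij_betw_def)
  qed
next
  fix \<xi> x y
  show "grid_char n d \<xi> (grid_add n d x y) = grid_char n d \<xi> x * grid_char n d \<xi> y"
    unfolding grid_char_def grid_add_def prod.distrib[symmetric]
    using n by (intro prod.cong refl) (simp add: unity_root_power_mod distrib_left power_add)
next
  fix \<xi> x show "norm (grid_char n d \<xi> x) = 1"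
    by (simp add: grid_char_def norm_power flip: prod_norm)
next
  fix x y assume xy: "x \<in> grid n d" "y \<in> grid n d"
  have lt: "x i < n" "y i < n" if "i < d" for i using xy that by (auto simp: grid_def PiE_def Pi_def)
  have "(\<Sum>\<xi>\<in>grid n d. grid_char n d \<xi> x * cnj (grid_char n d \<xi> y))
     = (\<Sum>\<xi>\<in>grid n d. \<Prod>i<d. unity_root n ^ (\<xi> i * x i) * cnj (unity_root n ^ (\<xi> i * y i)))"
    by (simp add: grid_char_def cnj_prod prod.distrib)
  \<comment> \<open>The sum over the grid factors into one geometric sum per coordinate.\<close>
  also have "\<dots> = (\<Prod>i<d. \<Sum>k<n. unity_root n ^ (k * x i) * cnj (unity_root n ^ (k * y i)))"
    unfolding grid_def by (subst prod_sum_PiE) auto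
  also have "\<dots> = (\<Prod>i<d. if x i = y i then of_nat n else 0)"
    using n lt by (intro prod.cong refl unity_root_orthogonal) auto
  also have "\<dots> = (if x = y then of_nat (card (grid n d)) else 0)"
  proof (cases "x = y")
    case True then show ?thesis by (simp add: grid_def card_PiE)
  next
    case False
    then obtain i where "i < d" "x i \<noteq> y i"
      using PiE_ext[OF xy[unfolded grid_def]] by auto
    then show ?thesis using False by (auto intro!: prod_zero)
  qed
  finally show "(\<Sum>\<xi>\<in>grid n d. grid_char n d \<xi> x * cnj (grid_char n d \<xi> y)) = (if x = y then of_nat (card (grid n d)) else 0)" .
next
  show "(\<lambda>i\<in>{..<d}. 0) \<in> grid n d" using n by (auto simp: grid_def)
next
  fix x show "grid_char n d (\<lambda>i\<in>{..<d}. 0) x = 1" by (simp add: grid_char_def)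
qed

text \<open>For n \<ge> 2, the least distance from 1 to another n-th root of unity. It is
  independent of the dimension of the grid.\<close>

definition unity_gap :: "nat \<Rightarrow> real" where
  "unity_gap n = Min ((\<lambda>j. norm (unity_root n ^ j - 1)) ` {1..<n})"

lemma unity_gap_pos:
  assumes "n \<ge> 2"
  shows "unity_gap n > 0"
proof -
  have "norm (unity_root n ^ j - 1) > 0" if "j \<in> {1..<n}" for j
    using inj_onD[OF unity_root_power_inj, of n j 0] that by auto
  moreover have "{1..<n} \<noteq> {}" using assms by auto
  ultimately show ?thesis unfolding unity_gap_def by (subst Min_gr_iff) auto
qed

lemma unity_gap_le: "0 < j \<Longrightarrow> j < n \<Longrightarrow> unity_gap n \<le> norm (unity_root n ^ j - 1)"
  unfolding unity_gap_def by (intro Min_le) auto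

text \<open>A nontrivial \<xi> has a nonzero coordinate i. Shifting by the i-th unit vector u
  multiplies the transform by a root of unity other than 1, at distance at least
  \<open>unity_gap n\<close> from 1, yet changes F by at most \<epsilon> pointwise. So every
  nontrivial coefficient is at most \<epsilon> / \<open>unity_gap n\<close> times the size of the
  grid, whatever d is.\<close>

lemma grid_mean_power_le:
  fixes F :: "(nat \<Rightarrow> nat) \<Rightarrow> real"
  assumes n: "n \<ge> 2"
    and range: "\<And>x. x \<in> grid n d \<Longrightarrow> 0 \<le> F x \<and> F x \<le> 1"
    and lip: "\<And>i x. i < d \<Longrightarrow> x \<in> grid n d \<Longrightarrow> \<bar>F (grid_add n d x (grid_unit d i)) - F x\<bar> \<le> \<epsilon>"
    and \<epsilon>: "0 \<le> \<epsilon>" and b: "b \<in> grid n d"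
    and disj: "\<And>x y. x \<in> grid n d \<Longrightarrow> y \<in> grid n d \<Longrightarrow> F (grid_add n d x y) = 0 \<or> F y = 0 \<or> F (grid_add n d x b) = 0"
  shows "((\<Sum>x\<in>grid n d. F x) / card (grid n d)) ^ 5 \<le> (\<epsilon> / unity_gap n)\<^sup>2"
proof -
  interpret finite_characters "grid n d" "grid n d" "grid_add n d" "grid_char n d" "\<lambda>i\<in>{..<d}. 0"
    by (rule grid_characters[OF n])
  show ?thesis
  proof (rule mean_power_le[OF _ _ range b disj refl])
    show "0 \<le> \<epsilon> / unity_gap n" using \<epsilon> unity_gap_pos[OF n] by simp
    fix \<xi> assume \<xi>: "\<xi> \<in> grid n d" "\<xi> \<noteq> (\<lambda>i\<in>{..<d}. 0)"
    then obtain i where i: "i < d" "\<xi> i \<noteq> 0"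
      using PiE_ext[OF \<xi>(1)[unfolded grid_def] trivial_in[unfolded grid_def]] by auto
    define u where "u = grid_unit d i"
    have u: "u \<in> grid n d" using n by (auto simp: u_def grid_unit_def grid_def)
    have "grid_char n d \<xi> u = (\<Prod>j<d. if j = i then unity_root n ^ \<xi> i else 1)"
      unfolding grid_char_def u_def grid_unit_def by (intro prod.cong) auto
    then have cu: "grid_char n d \<xi> u = unity_root n ^ \<xi> i" using i by (simp add: prod.delta)
    have "transform F \<xi> = (\<Sum>x\<in>grid n d. of_real (F (grid_add n d x u)) * grid_char n d \<xi> (grid_add n d x u))"
      unfolding transform_def by (rule sum_shift[OF u, symmetric])
    also have "\<dots> = grid_char n d \<xi> u * (\<Sum>x\<in>grid n d. of_real (F (grid_add n d x u)) * grid_char n d \<xi> x)"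
      unfolding sum_distrib_left using char_add[OF \<xi>(1) _ u] by (intro sum.cong refl) (simp add: mult_ac)
    finally have eq: "transform F \<xi> = grid_char n d \<xi> u * (\<Sum>x\<in>grid n d. of_real (F (grid_add n d x u)) * grid_char n d \<xi> x)" .
    have "(\<Sum>x\<in>grid n d. of_real (F (grid_add n d x u) - F x) * grid_char n d \<xi> x)
        = (\<Sum>x\<in>grid n d. of_real (F (grid_add n d x u)) * grid_char n d \<xi> x) - transform F \<xi>"
      by (simp add: transform_def left_diff_distrib sum_subtractf)
    moreover have "t * (1 - c) = c * D" if "t = c * A" "D = A - t" for t c A D :: complex
      unfolding that by (simp add: algebra_simps)
    ultimately have "transform F \<xi> * (1 - grid_char n d \<xi> u) = grid_char n d \<xi> u *
        (\<Sum>x\<in>grid n d. of_real (F (grid_add n d x u) - F x) * grid_char n d \<xi> x)"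
      using eq by blast
    then have "norm (transform F \<xi>) * norm (1 - grid_char n d \<xi> u)
        = norm (\<Sum>x\<in>grid n d. of_real (F (grid_add n d x u) - F x) * grid_char n d \<xi> x)"
      using norm_char[OF \<xi>(1) u] by (drule_tac arg_cong[where f = norm]) (simp only: norm_mult mult_1)
    also have "\<dots> \<le> (\<Sum>x\<in>grid n d. \<epsilon>)"
      by (rule sum_norm_le) (use lip i norm_char[OF \<xi>(1)] in \<open>simp add: norm_mult u_def del: of_real_diff\<close>)
    finally have le: "norm (transform F \<xi>) * norm (1 - grid_char n d \<xi> u) \<le> \<epsilon> * card (grid n d)"
      by (simp add: mult.commute)
    have "\<xi> i < n" using \<xi>(1) i by (auto simp: grid_def)
    then have "unity_gap n \<le> norm (1 - grid_char n d \<xi> u)"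
      unfolding cu using unity_gap_le[of "\<xi> i" n] i by (simp add: norm_minus_commute)
    then have "norm (transform F \<xi>) * unity_gap n \<le> \<epsilon> * card (grid n d)"
      by (intro order_trans[OF mult_left_mono le]) auto
    then show "norm (transform F \<xi>) \<le> \<epsilon> / unity_gap n * card (grid n d)" using unity_gap_pos[OF n] by (simp add: field_simps)
  qed
qed

section \<open>Divisibility of compact connected abelian groups\<close>

lemma int_mult_0 [simp]: "int_mult 0 a = 0"
  by (simp add: int_mult_def)

lemma int_mult_Suc: "int_mult (int (Suc m)) a = int_mult (int m) a + a"
  by (simp add: int_mult_def nat_add_distrib flip: of_nat_Suc)

lemma int_mult_minus: "int_mult (- k) a = - int_mult k a"
  by (auto simp: int_mult_def)

lemma int_mult_succ: "int_mult (k + 1) a = int_mult k a + a"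
proof (cases k rule: int_cases2)
  case (nonneg m)
  then show ?thesis using int_mult_Suc[of m a] by (simp add: add.commute)
next
  case (nonpos m)
  show ?thesis
  proof (cases m)
    case 0 then show ?thesis using nonpos int_mult_Suc[of 0 a] by simp
  next
    case (Suc l)
    have "int_mult (k + 1) a = - int_mult (int l) a"
      using nonpos Suc by (simp flip: int_mult_minus)
    moreover have "int_mult k a = - (int_mult (int l) a + a)"
      unfolding int_mult_Suc[symmetric] using nonpos Suc by (simp only: int_mult_minus)
    ultimately show ?thesis by simp
  qed
qed

lemma int_mult_1 [simp]: "int_mult 1 a = a"
  using int_mult_succ[of 0 a] by simp

lemma int_mult_add_left: "int_mult (k + l) a = int_mult k a + int_mult l a"
proof (induction l rule: int_induct[where k = 0])
  case (step1 i)
  then show ?case using int_mult_succ[of "k + i" a] int_mult_succ[of i a] by (simp add: add.assoc)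
next
  case (step2 i)
  then show ?case using int_mult_succ[of "k + i - 1" a] int_mult_succ[of "i - 1" a]
    by (simp add: algebra_simps)
qed simp

lemma int_mult_zero_right [simp]: "int_mult k 0 = 0"
  by (simp add: int_mult_def)

lemma int_mult_add_right: "int_mult k (a + b) = int_mult k a + int_mult k b"
  by (simp add: int_mult_def sum.distrib)

lemma int_mult_minus_right: "int_mult k (- a) = - int_mult k a"
  using int_mult_add_right[of k a "- a"] by (simp add: eq_neg_iff_add_eq_0 add.commute)

lemma int_mult_diff_right: "int_mult k (a - b) = int_mult k a - int_mult k b"
  using int_mult_add_right[of k a "- b"] by (simp add: int_mult_minus_right)

lemma int_mult_diff_left: "int_mult (k - l) a = int_mult k a - int_mult l a"
  using int_mult_add_left[of k "- l" a] by (simp add: int_mult_minus)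

lemma int_mult_mult: "int_mult (k * l) a = int_mult k (int_mult l a)"
proof (induction k rule: int_induct[where k = 0])
  case (step1 i)
  then show ?case by (simp add: distrib_right int_mult_add_left)
next
  case (step2 i)
  then show ?case by (simp add: left_diff_distrib int_mult_diff_left)
qed simp

lemma continuous_on_int_mult [continuous_intros]:
  fixes g :: "'b::topological_space \<Rightarrow> 'a::topological_ab_group_add"
  assumes "continuous_on S g"
  shows "continuous_on S (\<lambda>x. int_mult k (g x))"
proof -
  have nat: "continuous_on S (\<lambda>x. int_mult (int m) (g x))" for m
    by (induction m) (auto simp only: int_mult_Suc of_nat_0 int_mult_0 intro!: continuous_intros assms)
  show ?thesis
  proof (cases k rule: int_cases2)
    case (nonpos m)
    then show ?thesis using nat by (simp add: int_mult_minus continuous_on_minus)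
  qed (use nat in auto)
qed

section \<open>Continuous functions on compact groups, and compact connected subgroups\<close>

lemma Urysohn_compact:
  fixes S T :: "'a::t2_space set"
  assumes "compact (UNIV :: 'a set)" "closed S" "closed T" "S \<inter> T = {}"
  obtains \<phi> :: "'a \<Rightarrow> real" where "continuous_on UNIV \<phi>" "\<And>x. 0 \<le> \<phi> x \<and> \<phi> x \<le> 1"
    "\<And>x. x \<in> S \<Longrightarrow> \<phi> x = 0" "\<And>x. x \<in> T \<Longrightarrow> \<phi> x = 1"
proof -
  have "Hausdorff_space (euclidean :: 'a topology)" by (simp add: Hausdorff_space_def disjnt_def) (metis hausdorff)
  moreover have "compact_space (euclidean :: 'a topology)" using assms(1) by (simp add: compact_space_def)
  ultimately have "normal_space (euclidean :: 'a topology)"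
    using compact_Hausdorff_or_regular_imp_normal_space by blast
  from Urysohn_lemma[OF this, of S T 0 1] obtain \<phi> where
    "continuous_map euclidean (top_of_set {0..1::real}) \<phi>" "\<phi> ` S \<subseteq> {0}" "\<phi> ` T \<subseteq> {1}"
    using assms by (auto simp: disjnt_def)
  then show thesis
    by (intro that[of \<phi>]) (auto simp: continuous_map_in_subtopology image_subset_iff)
qed

text \<open>A tube argument for the map sending (u, x) to \<phi> (x + u) near u = 0, with x ranging
  over the compact group.\<close>

lemma uniformly_continuous_compact_group:
  fixes \<phi> :: "'a::topological_ab_group_add \<Rightarrow> real"
  assumes "compact (UNIV :: 'a set)" "continuous_on UNIV \<phi>" "\<epsilon> > 0"
  obtains U where "open U" "0 \<in> U" "\<And>u x. u \<in> U \<Longrightarrow> \<bar>\<phi> (x + u) - \<phi> x\<bar> \<le> \<epsilon>"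
proof -
  have "continuous_on (UNIV \<times> UNIV) (\<lambda>p. \<phi> (snd p + fst p))"
    by (intro continuous_on_compose2[OF assms(2)] continuous_intros) auto
  then show thesis
  proof (rule continuous_on_prod_compactE[OF _ assms(1) UNIV_I assms(3), where ?x0.0 = 0])
    fix U :: "'a set"
    assume "0 \<in> U" "open U" and U: "\<forall>x\<in>U \<inter> UNIV. \<forall>t\<in>UNIV.
      dist (\<phi> (snd (x, t) + fst (x, t))) (\<phi> (snd (0, t) + fst (0, t))) \<le> \<epsilon>"
    then show thesis by (intro that[of U]) (auto simp: dist_real_def)
  qed
qed

locale compact_connected_subgroup =
  fixes H :: "'a::{topological_ab_group_add,t2_space} set"
  assumes compact_UNIV: "compact (UNIV :: 'a set)"
    and compact: "compact H" and connected: "connected H"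
    and zero_mem: "0 \<in> H" and diff_mem: "x \<in> H \<Longrightarrow> y \<in> H \<Longrightarrow> x - y \<in> H"
begin

lemma minus_mem: "x \<in> H \<Longrightarrow> - x \<in> H"
  using diff_mem[OF zero_mem] by simp

lemma add_mem: "x \<in> H \<Longrightarrow> y \<in> H \<Longrightarrow> x + y \<in> H"
  using diff_mem[of x "- y"] minus_mem by simp

lemma sum_mem: "(\<And>i. i \<in> A \<Longrightarrow> g i \<in> H) \<Longrightarrow> sum g A \<in> H"
  by (induction A rule: infinite_finite_induct) (auto simp: zero_mem add_mem)

lemma int_mult_mem: "x \<in> H \<Longrightarrow> int_mult k x \<in> H"
  by (simp add: int_mult_def sum_mem minus_mem)

lemma add_mem_cancel: "x \<in> H \<Longrightarrow> x + y \<in> H \<longleftrightarrow> y \<in> H"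
  using diff_mem[of "x + y" x] by (auto simp: add_mem)

text \<open>The set R of finite sums from the symmetric neighbourhood V of 0 in H is stable under
  adding elements of V, and by symmetry so is its complement in H. Both are thus open in H, and
  connectedness leaves R = H.\<close>

lemma generated_by_neighbourhood:
  assumes "open U" "0 \<in> U" "h \<in> H"
  obtains us where "set us \<subseteq> U \<inter> H" "sum_list us = h"
proof -
  define V where "V = (U \<inter> uminus -` U) \<inter> H"
  define R where "R = sum_list ` {us. set us \<subseteq> V}"
  have sumH: "sum_list us \<in> H" if "set us \<subseteq> V" for us
    using that by (induction us) (auto simp: V_def zero_mem add_mem)
  have Rs: "R \<subseteq> H" using sumH by (auto simp: R_def)
  have step: "x + v \<in> R" if "x \<in> R" "v \<in> V" for x v
  proof -
    obtain us where "set us \<subseteq> V" "x = sum_list us" using \<open>x \<in> R\<close> by (auto simp: R_def)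
    then show ?thesis unfolding R_def using that by (intro image_eqI[of _ _ "us @ [v]"]) auto
  qed
  have openV: "open (U \<inter> uminus -` U)"
    using assms(1) by (intro open_Int open_vimage continuous_intros)
  have nb: "open ((\<lambda>y. y - x) -` (U \<inter> uminus -` U))" "x \<in> (\<lambda>y. y - x) -` (U \<inter> uminus -` U)" for x
    using openV assms(2) by (auto intro!: open_vimage continuous_intros simp del: vimage_Int)
  have "openin (top_of_set H) R"
  proof (subst openin_subopen, intro ballI exI conjI)
    fix x assume "x \<in> R"
    let ?T = "H \<inter> (\<lambda>y. y - x) -` (U \<inter> uminus -` U)"
    show "openin (top_of_set H) ?T" using nb(1) by blast
    show "x \<in> ?T" using nb(2) \<open>x \<in> R\<close> Rs by blast
    show "?T \<subseteq> R"
    proof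
      fix y assume y: "y \<in> ?T"
      then have "y - x \<in> V" using \<open>x \<in> R\<close> Rs diff_mem by (auto simp: V_def)
      from step[OF \<open>x \<in> R\<close> this] show "y \<in> R" by simp
    qed
  qed
  moreover have "openin (top_of_set H) (H - R)"
  proof (subst openin_subopen, intro ballI exI conjI)
    fix x assume x: "x \<in> H - R"
    let ?T = "H \<inter> (\<lambda>y. y - x) -` (U \<inter> uminus -` U)"
    show "openin (top_of_set H) ?T" using nb(1) by blast
    show "x \<in> ?T" using nb(2) x by blast
    show "?T \<subseteq> H - R"
    proof
      fix y assume y: "y \<in> ?T"
      then have "x - y \<in> V" using x diff_mem by (auto simp: V_def)
      then have "x \<in> R" if "y \<in> R" using step[OF that, of "x - y"] by simp
      then show "y \<in> H - R" using x y by blast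
    qed
  qed
  moreover have "0 \<in> R" unfolding R_def by (rule image_eqI[of _ _ "[]"]) auto
  ultimately have "R = H"
    using connected Rs unfolding connected_clopen
    by (metis closedin_def empty_iff openin_closedin_eq topspace_euclidean_subtopology)
  then obtain us where "set us \<subseteq> V" "sum_list us = h"
    using assms(3) by (auto simp: R_def)
  then show thesis by (intro that) (auto simp: V_def)
qed

text \<open>The lists that represent the single elements are concatenated. Every h then has
  coefficients 0 and 1 in the common generators, so it comes from a point of the grid for any n
  \<ge> 2.\<close>

lemma subset_sums_in_neighbourhood:
  assumes U: "open U" "0 \<in> U" and F: "finite F" "F \<subseteq> H"
  obtains d and u :: "nat \<Rightarrow> 'a" where "\<And>i. i < d \<Longrightarrow> u i \<in> U \<inter> H"
    "\<And>h. h \<in> F \<Longrightarrow> \<exists>B\<subseteq>{..<d}. h = (\<Sum>i\<in>B. u i)"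
proof -
  have "\<exists>(d::nat) u. (\<forall>i<d. u i \<in> U \<inter> H) \<and> (\<forall>h\<in>F. \<exists>B\<subseteq>{..<d}. h = (\<Sum>i\<in>B. u i))"
    using F
  proof (induction F rule: finite_induct)
    case empty
    show ?case by (intro exI[of _ 0]) auto
  next
    case (insert h F)
    then obtain d and u :: "nat \<Rightarrow> 'a" where d: "\<forall>i<d. u i \<in> U \<inter> H"
      and F: "\<forall>h\<in>F. \<exists>B\<subseteq>{..<d}. h = (\<Sum>i\<in>B. u i)" by auto
    obtain vs where vs: "set vs \<subseteq> U \<inter> H" "sum_list vs = h"
      using generated_by_neighbourhood[OF U, of h] insert.prems by auto
    define u' where "u' i = (if i < d then u i else vs ! (i - d))" for i
    show ?case
    proof (rule exI[of _ "d + length vs"], rule exI[of _ u'], intro conjI allI impI ballI)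
      fix i assume "i < d + length vs"
      then show "u' i \<in> U \<inter> H"
        unfolding u'_def using d vs nth_mem[of "i - d" vs] by (cases "i < d") (simp_all add: subset_iff)
    next
      fix g assume "g \<in> insert h F"
      then consider "g \<in> F" | "g = h" by blast
      then show "\<exists>B\<subseteq>{..<d + length vs}. g = (\<Sum>i\<in>B. u' i)"
      proof cases
        case 1
        then obtain B where B: "B \<subseteq> {..<d}" "g = (\<Sum>i\<in>B. u i)" using F by blast
        moreover have "(\<Sum>i\<in>B. u i) = (\<Sum>i\<in>B. u' i)" using B(1) by (intro sum.cong) (auto simp: u'_def)
        ultimately show ?thesis by (intro exI[of _ B]) auto
      next
        case 2
        have "h = (\<Sum>i<length vs. vs ! i)" using vs(2) by (simp add: sum_list_sum_nth atLeast0LessThan)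
        also have "\<dots> = (\<Sum>i\<in>{0 + d..<length vs + d}. u' i)"
          unfolding sum.shift_bounds_nat_ivl by (simp add: u'_def atLeast0LessThan)
        finally show ?thesis using 2 by (intro exI[of _ "{0 + d..<length vs + d}"]) auto
      qed
    qed
  qed
  then show thesis using that by metis
qed


text \<open>The quotient \<open>H / m H\<close> has exponent \<open>m\<close>, so finitely many of its elements generate a finite
  group, a quotient of a grid. As \<open>H\<close> is connected, these generators can be chosen arbitrarily close
  to \<open>0\<close>. A continuous function on \<open>H / m H\<close> with small support then varies little along each
  generator, hence has no large nontrivial Fourier coefficient on the grid, and its
  autocorrelation cannot vanish anywhere.\<close>

lemma divisible_nat:
  assumes n: "n \<ge> 2" and x0: "x0 \<in> H"
  shows "x0 \<in> int_mult (int n) ` H"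
proof (rule ccontr)
  define K where "K = int_mult (int n) ` H"
  assume "x0 \<notin> int_mult (int n) ` H"
  then have x0K: "x0 \<notin> K" by (simp add: K_def)
  have Kdiff: "x - y \<in> K" if "x \<in> K" "y \<in> K" for x y
    using that unfolding K_def by (auto simp: diff_mem simp flip: int_mult_diff_right)
  have K0: "0 \<in> K" unfolding K_def using zero_mem by (intro image_eqI[of _ _ 0]) auto
  have Kadd: "x + y \<in> K" if "x \<in> K" "y \<in> K" for x y
    using Kdiff[of x "- y"] Kdiff[OF K0, of y] that by simp
  have Ksum: "sum g A \<in> K" if "\<And>i. i \<in> A \<Longrightarrow> g i \<in> K" for g :: "nat \<Rightarrow> 'a" and A
    using that by (induction A rule: infinite_finite_induct) (auto simp: K0 Kadd)
  have "compact K" unfolding K_def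
    by (intro compact_continuous_image compact continuous_intros)
  then have "open (- K)" by (simp add: compact_imp_closed open_Compl)
  \<comment> \<open>The three small elements a, b, c will come from three simultaneously nonzero
    values of F. Their combination with \<open>x0\<close> would then lie in K, which is the
    contradiction behind \<open>disj\<close>.\<close>
  define W where "W = (\<lambda>(a, b, c). x0 + c - a + b) -` (- K)"
  have "open W" unfolding W_def
    using \<open>open (- K)\<close> by (intro open_vimage) (auto simp: split_beta intro!: continuous_intros)
  moreover have "(0, 0, 0) \<in> W" using x0K by (simp add: W_def)
  ultimately obtain A B' where A: "open A" "open B'" "(0, 0, 0) \<in> A \<times> B'" "A \<times> B' \<subseteq> W"
    by (rule open_prod_elim)
  from A(3) have "(0, 0) \<in> B'" by simp
  with A(2) obtain B C where B: "open B" "open C" "(0, 0) \<in> B \<times> C" "B \<times> C \<subseteq> B'"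
    by (rule open_prod_elim)
  define V where "V = A \<inter> B \<inter> C"
  have V: "open V" "0 \<in> V" using A B by (auto simp: V_def)
  have V_sep: "x0 + c - a + b \<notin> K" if "a \<in> V" "b \<in> V" "c \<in> V" for a b c
  proof -
    have "(a, b, c) \<in> W" using that A B unfolding V_def by blast
    then show ?thesis by (simp add: W_def)
  qed
  obtain \<phi> :: "'a \<Rightarrow> real" where \<phi>: "continuous_on UNIV \<phi>" "\<And>x. 0 \<le> \<phi> x \<and> \<phi> x \<le> 1"
    "\<And>x. x \<in> - V \<Longrightarrow> \<phi> x = 0" "\<And>x. x \<in> {0} \<Longrightarrow> \<phi> x = 1"
    using Urysohn_compact[OF compact_UNIV, of "- V" "{0}"] V by auto
  \<comment> \<open>The supremum over a coset of K makes the bump invariant under K, that is, a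
    function on the quotient, and keeps its modulus of continuity.\<close>
  define f where "f x = (SUP k\<in>K. \<phi> (x + k))" for x
  have bdd: "bdd_above ((\<lambda>k. \<phi> (x + k)) ` K)" for x using \<phi>(2) by (auto intro!: bdd_aboveI[of _ 1])
  have f_ge: "\<phi> (x + k) \<le> f x" if "k \<in> K" for x k
    unfolding f_def using bdd that by (rule cSUP_upper2[OF _ _ order_refl])
  have f_le: "f x \<le> t" if "\<And>k. k \<in> K \<Longrightarrow> \<phi> (x + k) \<le> t" for x t
    unfolding f_def using K0 that by (intro cSUP_least) auto
  have f01: "0 \<le> f x \<and> f x \<le> 1" for x
    using f_le[of x 1] f_ge[OF K0, of x] \<phi>(2) by (meson order_trans)
  have f_ge\<phi>: "\<phi> x \<le> f x" for x using f_ge[OF K0, of x] by simp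
  have f_inv: "f (x + k) = f x" if "k \<in> K" for x k
  proof (rule antisym)
    show "f (x + k) \<le> f x"
      by (rule f_le) (use f_ge Kadd[OF that] in \<open>simp add: add.assoc\<close>)
    show "f x \<le> f (x + k)"
    proof (rule f_le)
      fix l assume "l \<in> K"
      then show "\<phi> (x + l) \<le> f (x + k)" using f_ge[OF Kdiff[of l k], of "x + k"] that by simp
    qed
  qed
  have f_cong: "f x = f y" if "x - y \<in> K" for x y using f_inv[OF that, of y] by simp
  have f_supp: "\<exists>k\<in>K. x + k \<in> V" if "f x \<noteq> 0" for x
  proof (rule ccontr)
    assume "\<not> (\<exists>k\<in>K. x + k \<in> V)"
    then have "f x \<le> 0" using \<phi>(3) by (intro f_le) auto
    then show False using f01[of x] that by simp
  qed

  define V1 where "V1 = \<phi> -` {1/2<..}"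
  have V1: "open V1" "0 \<in> V1" using \<phi>(1,4) by (auto simp: V1_def intro: open_vimage)
  have "\<exists>F0\<subseteq>H. finite F0 \<and> H \<subseteq> (\<Union>h\<in>F0. (\<lambda>x. x - h) -` V1)"
  proof (rule compactE_image[OF compact, of H "\<lambda>h. (\<lambda>x. x - h) -` V1"])
    show "open ((\<lambda>x. x - h) -` V1)" for h
      using V1(1) by (intro open_vimage continuous_intros)
    show "H \<subseteq> (\<Union>h\<in>H. (\<lambda>x. x - h) -` V1)" using V1(2) by auto
  qed blast
  then obtain F0 where F0: "F0 \<subseteq> H" "finite F0" "H \<subseteq> (\<Union>h\<in>F0. (\<lambda>x. x - h) -` V1)" by blast
  define N0 where "N0 = real (card F0)"
  have "F0 \<noteq> {}" using F0(3) zero_mem by blast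
  then have "card F0 \<noteq> 0" using F0(2) by simp
  then have N0: "N0 \<ge> 1" by (simp add: N0_def)
  \<comment> \<open>A lower bound for the mean of F on any grid used below: the translates of \<phi>
    > 1/2 by the \<open>N0\<close> elements of \<open>F0\<close> cover H, so \<open>N0\<close>
    shifts of F add up to at least 1/2 everywhere.\<close>
  define c0 where "c0 = 1 / (2 * N0)"
  have c0: "0 < c0" "c0 < 1" using N0 by (auto simp: c0_def field_simps)
  define \<kappa> where "\<kappa> = unity_gap n"
  have \<kappa>: "\<kappa> > 0" unfolding \<kappa>_def by (rule unity_gap_pos[OF n])
  \<comment> \<open>With this choice (\<epsilon> / \<kappa>)^2 = c0^6 < c0^5, against c0^5 \<le>
    c^5. Neither c0 nor \<kappa> refers to the generators, which are chosen afterwards from the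
    neighbourhood U belonging to \<epsilon>.\<close>
  define \<epsilon> where "\<epsilon> = \<kappa> * c0 ^ 3"
  have \<epsilon>: "\<epsilon> > 0" using \<kappa> c0 by (simp add: \<epsilon>_def)
  obtain U where U: "open U" "0 \<in> U" and unif\<phi>: "\<And>u x. u \<in> U \<Longrightarrow> \<bar>\<phi> (x + u) - \<phi> x\<bar> \<le> \<epsilon>"
    by (rule uniformly_continuous_compact_group[OF compact_UNIV \<phi>(1) \<epsilon>]) blast
  have unif: "\<bar>f (x + u) - f x\<bar> \<le> \<epsilon>" if "u \<in> U" for u x
  proof -
    have "f (x + u) \<le> f x + \<epsilon>"
    proof (rule f_le)
      fix k assume "k \<in> K"
      then show "\<phi> (x + u + k) \<le> f x + \<epsilon>"
        using unif\<phi>[OF that, of "x + k"] f_ge[of k x] by (simp add: add_ac)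
    qed
    moreover have "f x \<le> f (x + u) + \<epsilon>"
    proof (rule f_le)
      fix k assume "k \<in> K"
      then show "\<phi> (x + k) \<le> f (x + u) + \<epsilon>"
        using unif\<phi>[OF that, of "x + k"] f_ge[of k "x + u"] by (simp add: add_ac)
    qed
    ultimately show ?thesis by linarith
  qed
  \<comment> \<open>Negatives, because the grid points must realize the shifts by -h in the covering
    argument and by \<open>- x0\<close> in the separation argument.\<close>
  have "finite (uminus ` insert x0 F0)" "uminus ` insert x0 F0 \<subseteq> H"
    using F0 x0 minus_mem by auto
  from subset_sums_in_neighbourhood[OF U this] obtain d and u :: "nat \<Rightarrow> 'a" where
    u: "\<And>i. i < d \<Longrightarrow> u i \<in> U \<inter> H"
    and gen: "\<And>h. h \<in> uminus ` insert x0 F0 \<Longrightarrow> \<exists>B\<subseteq>{..<d}. h = (\<Sum>i\<in>B. u i)" by metis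
  define X where "X a = (\<Sum>i<d. int_mult (int (a i)) (u i))" for a :: "nat \<Rightarrow> nat"
  have XH: "X a \<in> H" for a unfolding X_def using u by (intro sum_mem int_mult_mem) auto
  \<comment> \<open>X is additive only modulo K: reducing a coordinate modulo n drops n times an
    element of H. As f is invariant under K, F does not notice.\<close>
  have X_add: "X (grid_add n d a b) - (X a + X b) \<in> K" for a b
  proof -
    have "int_mult (int ((a i + b i) mod n)) (u i) - (int_mult (int (a i)) (u i) + int_mult (int (b i)) (u i)) \<in> K"
      if "i < d" for i
    proof -
      define q where "q = (a i + b i) div n"
      have "int ((a i + b i) mod n) = int (a i) + int (b i) - int n * int q"
        by (simp add: q_def zmod_int zdiv_int minus_mult_div_eq_mod)
      then have "int_mult (int ((a i + b i) mod n)) (u i) - (int_mult (int (a i)) (u i) + int_mult (int (b i)) (u i))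
          = int_mult (int n) (int_mult (- int q) (u i))"
        by (simp add: int_mult_diff_left int_mult_add_left int_mult_mult int_mult_minus int_mult_minus_right)
      then show ?thesis unfolding K_def using u[OF that] int_mult_mem by auto
    qed
    then have "(\<Sum>i<d. int_mult (int ((a i + b i) mod n)) (u i) - (int_mult (int (a i)) (u i) + int_mult (int (b i)) (u i))) \<in> K"
      by (intro Ksum) auto
    then show ?thesis by (simp add: X_def grid_add_def sum_subtractf sum.distrib)
  qed
  have gen': "\<exists>b\<in>grid n d. X b = h" if h: "h \<in> uminus ` insert x0 F0" for h
  proof -
    obtain B where B: "B \<subseteq> {..<d}" "h = (\<Sum>i\<in>B. u i)" using gen[OF h] by blast
    define b where "b = (\<lambda>i\<in>{..<d}. if i \<in> B then 1 else 0 :: nat)"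
    have "X b = (\<Sum>i<d. if i \<in> B then u i else 0)"
      unfolding X_def b_def by (intro sum.cong) auto
    also have "\<dots> = h" using B by (simp add: sum.inter_restrict[symmetric] Int_absorb1)
    finally show ?thesis using n by (intro bexI[of _ b]) (auto simp: b_def grid_def)
  qed
  then obtain b0 where b0: "b0 \<in> grid n d" "X b0 = - x0" by blast
  define F where "F a = f (X a)" for a
  have F_add: "F (grid_add n d a b) = f (X a + X b)" for a b
    unfolding F_def by (rule f_cong[OF X_add])
  define c where "c = (\<Sum>x\<in>grid n d. F x) / card (grid n d)"
  have "c ^ 5 \<le> (\<epsilon> / \<kappa>)\<^sup>2"
    unfolding c_def \<kappa>_def
  proof (rule grid_mean_power_le[OF n _ _ _ b0(1)])
    show "0 \<le> F x \<and> F x \<le> 1" for x unfolding F_def by (rule f01)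
    show "0 \<le> \<epsilon>" using \<epsilon> by simp
    fix i x assume "i < d"
    have "X (grid_unit d i) = (\<Sum>j<d. if j = i then u i else 0)"
      unfolding X_def grid_unit_def by (intro sum.cong) auto
    then have "X (grid_unit d i) = u i" using \<open>i < d\<close> by simp
    then show "\<bar>F (grid_add n d x (grid_unit d i)) - F x\<bar> \<le> \<epsilon>"
      unfolding F_add using unif[of "u i" "X x"] u[OF \<open>i < d\<close>] by (simp add: F_def)
  next
    fix x y
    show "F (grid_add n d x y) = 0 \<or> F y = 0 \<or> F (grid_add n d x b0) = 0"
    proof (rule ccontr)
      assume "\<not> ?thesis"
      then have "f (X x + X y) \<noteq> 0" "f (X y) \<noteq> 0" "f (X x + X b0) \<noteq> 0"
        unfolding F_add by (simp_all add: F_def)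
      from this[THEN f_supp] obtain k1 k2 k3 where k: "k1 \<in> K" "k2 \<in> K" "k3 \<in> K"
        and kV: "X x + X y + k1 \<in> V" "X y + k2 \<in> V" "X x + X b0 + k3 \<in> V"
        by auto
      have eq: "x0 + (X x + X b0 + k3) - (X x + X y + k1) + (X y + k2) = k3 - k1 + k2"
        by (simp add: b0 algebra_simps)
      have "x0 + (X x + X b0 + k3) - (X x + X y + k1) + (X y + k2) \<in> K"
        unfolding eq using k Kadd Kdiff by blast
      with V_sep[OF kV] show False by contradiction
    qed
  qed
  moreover have "c \<ge> c0"
  proof -
    interpret finite_characters "grid n d" "grid n d" "grid_add n d" "grid_char n d" "\<lambda>i\<in>{..<d}. 0"
      by (rule grid_characters[OF n])
    have "\<exists>b. b \<in> grid n d \<and> X b = - h" if h: "h \<in> F0" for h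
    proof -
      have "- h \<in> uminus ` insert x0 F0" using h by simp
      from gen'[OF this] show ?thesis by blast
    qed
    then have "\<forall>h\<in>F0. \<exists>b. b \<in> grid n d \<and> X b = - h" by simp
    from bchoice[OF this] obtain \<beta> where \<beta>: "\<forall>h\<in>F0. \<beta> h \<in> grid n d \<and> X (\<beta> h) = - h"
      by blast
    have "card (grid n d) / 2 = (\<Sum>x\<in>grid n d. 1 / 2 :: real)" by simp
    also have "\<dots> \<le> (\<Sum>x\<in>grid n d. \<Sum>h\<in>F0. F (grid_add n d x (\<beta> h)))"
    proof (rule sum_mono)
      fix x
      obtain h where h: "h \<in> F0" "X x - h \<in> V1" using F0(3) XH[of x] by auto
      have "1 / 2 \<le> f (X x - h)" using f_ge\<phi>[of "X x - h"] h(2) by (simp add: V1_def)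
      also have "\<dots> = F (grid_add n d x (\<beta> h))" using \<beta> h(1) by (simp add: F_add)
      also have "\<dots> \<le> (\<Sum>h\<in>F0. F (grid_add n d x (\<beta> h)))"
        using F0(2) h(1) f01 by (intro member_le_sum) (auto simp: F_def)
      finally show "1 / 2 \<le> (\<Sum>h\<in>F0. F (grid_add n d x (\<beta> h)))" .
    qed
    also have "\<dots> = (\<Sum>h\<in>F0. \<Sum>x\<in>grid n d. F (grid_add n d x (\<beta> h)))" by (rule sum.swap)
    also have "\<dots> = (\<Sum>h\<in>F0. \<Sum>x\<in>grid n d. F x)"
      using \<beta> by (intro sum.cong refl sum_shift) auto
    also have "\<dots> = N0 * (\<Sum>x\<in>grid n d. F x)" by (simp add: N0_def)
    finally have "card (grid n d) / 2 \<le> N0 * (\<Sum>x\<in>grid n d. F x)" .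
    moreover have "card (grid n d) > 0" using fin_I b0(1) by (auto simp: card_gt_0_iff)
    ultimately show ?thesis using N0 by (simp add: c0_def c_def field_simps)
  qed
  then have "c0 ^ 5 \<le> c ^ 5" using c0 by (intro power_mono) auto
  moreover have "(\<epsilon> / \<kappa>)\<^sup>2 = c0 ^ 5 * c0" using \<kappa> by (simp add: \<epsilon>_def flip: power_mult power_Suc2)
  ultimately have "c0 ^ 5 * 1 \<le> c0 ^ 5 * c0" by linarith
  then show False using c0 by simp
qed

lemma divisible:
  assumes "p \<noteq> 0" "x \<in> H"
  obtains y where "y \<in> H" "int_mult p y = x"
proof -
  have nat: "\<exists>y\<in>H. int_mult (int m) y = x" if "m > 0" "x \<in> H" for m x
  proof (cases "m = 1")
    case False
    then show ?thesis using divisible_nat[of m x] that by auto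
  qed (use that in auto)
  show thesis
  proof (cases "p > 0")
    case True
    then obtain y where "y \<in> H" "int_mult (int (nat p)) y = x"
      using nat[of "nat p" x] assms by auto
    with True show thesis by (intro that[of y]) simp_all
  next
    case False
    then obtain y where "y \<in> H" "int_mult (int (nat (- p))) y = - x"
      using nat[of "nat (- p)" "- x"] assms minus_mem by auto
    with False show thesis by (intro that[of y]) (simp_all add: int_mult_minus)
  qed
qed

end

section \<open>Baire sets and the second Borel--Cantelli lemma\<close>

definition cozero_sets :: "'a::topological_space set set" where
  "cozero_sets = {V. \<exists>g :: 'a \<Rightarrow> real. continuous_on UNIV g \<and> V = {x. 0 < g x}}"

text \<open>The smallest sigma-algebra for which all continuous real functions are measurable; level
  sets at other heights are covered by subtracting constants.\<close>

definition baire :: "'a::topological_space measure" where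
  "baire = sigma UNIV cozero_sets"

lemma space_baire [simp]: "space baire = UNIV"
  by (simp add: baire_def space_measure_of_conv)

lemma sets_baire: "sets baire = sigma_sets UNIV cozero_sets"
  by (simp add: baire_def sets_measure_of_conv)

lemma cozero_baire: "V \<in> cozero_sets \<Longrightarrow> V \<in> sets baire"
  by (simp add: sets_baire)

lemma open_cozero: "V \<in> cozero_sets \<Longrightarrow> open V"
  by (auto simp: cozero_sets_def intro!: open_Collect_less continuous_intros)

lemma sets_baire_subset_borel: "sets baire \<subseteq> sets borel"
proof -
  have "cozero_sets \<subseteq> sets borel" by (auto intro: borel_open open_cozero)
  from sets.sigma_sets_subset[OF this] show ?thesis by (simp add: sets_baire)
qed

lemma measurable_baire:
  assumes "\<And>V. V \<in> cozero_sets \<Longrightarrow> h -` V \<inter> space N \<in> sets N"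
  shows "h \<in> measurable N baire"
  unfolding baire_def by (rule measurable_measure_of) (use assms in auto)

lemma continuous_cozero_vimage:
  assumes "continuous_on UNIV h" "V \<in> cozero_sets"
  shows "h -` V \<in> cozero_sets"
proof -
  obtain g :: "_ \<Rightarrow> real" where g: "continuous_on UNIV g" "V = {x. 0 < g x}"
    using assms(2) by (auto simp: cozero_sets_def)
  show ?thesis unfolding cozero_sets_def
  proof (intro CollectI exI conjI)
    show "continuous_on UNIV (\<lambda>x. g (h x))"
      by (rule continuous_on_compose2[OF g(1) assms(1)]) simp
    show "h -` V = {x. 0 < g (h x)}" using g(2) by auto
  qed
qed

lemma continuous_measurable_baire_baire:
  "continuous_on UNIV h \<Longrightarrow> h \<in> measurable baire baire"
  by (rule measurable_baire) (auto intro: cozero_baire continuous_cozero_vimage)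

text \<open>Open sets of a product need not be measurable for the product of the Borel algebras,
  since no countability is assumed; cozero sets of a compact product are.\<close>

lemma cozero_product_measurable:
  fixes V :: "('a::topological_space \<times> 'b::topological_space) set"
  assumes "compact (UNIV :: 'a set)" "compact (UNIV :: 'b set)" "V \<in> cozero_sets"
  shows "V \<in> sets (borel \<Otimes>\<^sub>M borel)"
proof -
  obtain g :: "'a \<times> 'b \<Rightarrow> real" where g: "continuous_on UNIV g" "V = {x. 0 < g x}"
    using assms(3) by (auto simp: cozero_sets_def)
  have comp: "compact (UNIV :: ('a \<times> 'b) set)"
    using compact_Times[OF assms(1,2)] by simp
  \<comment> \<open>Each superlevel set of g at a positive height is compact, so finitely many open
    boxes inside V cover it; V is the countable union of these finite unions.\<close>
  have "\<exists>R. R \<in> sets (borel \<Otimes>\<^sub>M borel) \<and> {p. inverse (Suc m) \<le> g p} \<subseteq> R \<and> R \<subseteq> V" for m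
  proof -
    let ?C = "{p. inverse (Suc m) \<le> g p}"
    have "closed ?C" using g(1) by (intro closed_Collect_le continuous_intros)
    then have C: "compact ?C" using compact_Int_closed[OF comp] by simp
    have "\<exists>A B. open A \<and> open B \<and> p \<in> A \<times> B \<and> A \<times> B \<subseteq> V" if "p \<in> ?C" for p
    proof -
      have "0 < inverse (real (Suc m))" by simp
      also have "\<dots> \<le> g p" using that by simp
      finally have "p \<in> V" by (simp add: g(2))
      then show ?thesis using open_cozero[OF assms(3)] by (metis open_prod_elim)
    qed
    then obtain A B where AB: "\<And>p. p \<in> ?C \<Longrightarrow> open (A p) \<and> open (B p) \<and> p \<in> A p \<times> B p \<and> A p \<times> B p \<subseteq> V"
      by metis
    obtain P where P: "P \<subseteq> ?C" "finite P" "?C \<subseteq> (\<Union>p\<in>P. A p \<times> B p)"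
    proof (rule compactE_image[OF C, of ?C "\<lambda>p. A p \<times> B p"])
      show "open (A p \<times> B p)" if "p \<in> ?C" for p using AB[OF that] by (auto intro: open_Times)
      show "?C \<subseteq> (\<Union>p\<in>?C. A p \<times> B p)" using AB by blast
    qed
    show ?thesis
    proof (intro exI conjI)
      show "(\<Union>p\<in>P. A p \<times> B p) \<in> sets (borel \<Otimes>\<^sub>M borel)"
        using P AB by (intro sets.finite_UN pair_measureI) auto
      show "(\<Union>p\<in>P. A p \<times> B p) \<subseteq> V" using P AB by blast
    qed (rule P)
  qed
  then obtain R where R: "\<And>m. R m \<in> sets (borel \<Otimes>\<^sub>M borel)"
    "\<And>m. {p. inverse (Suc m) \<le> g p} \<subseteq> R m" "\<And>m. R m \<subseteq> V" by metis
  have "V = (\<Union>m. R m)"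
  proof
    show "V \<subseteq> (\<Union>m. R m)"
    proof
      fix p assume "p \<in> V"
      then obtain m where "inverse (real (Suc m)) < g p" unfolding g(2) using reals_Archimedean by blast
      then have "p \<in> R m" using R(2)[of m] by auto
      then show "p \<in> (\<Union>m. R m)" by blast
    qed
  qed (use R(3) in blast)
  then show ?thesis using R(1) by auto
qed

lemma continuous_product_measurable_baire:
  fixes h :: "'a::topological_space \<times> 'b::topological_space \<Rightarrow> 'c::topological_space"
  assumes "compact (UNIV :: 'a set)" "compact (UNIV :: 'b set)" "continuous_on UNIV h"
  shows "h \<in> measurable (borel \<Otimes>\<^sub>M borel) baire"
  by (rule measurable_baire)
    (auto simp: space_pair_measure intro: cozero_product_measurable assms continuous_cozero_vimage)

section \<open>Haar measure, and Baire approximation of Borel sets\<close>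

lemma haar_sets: "normalized_haar_measure M \<Longrightarrow> sets M = sets borel"
  unfolding normalized_haar_measure_def by (elim conjE)

lemma haar_space: "normalized_haar_measure M \<Longrightarrow> space M = UNIV"
  by (drule haar_sets, drule sets_eq_imp_space_eq) simp

lemma haar_prob_space: "normalized_haar_measure M \<Longrightarrow> prob_space M"
  by (rule prob_spaceI) (simp add: haar_space, simp only: normalized_haar_measure_def)

lemma haar_translate:
  assumes "normalized_haar_measure M" "A \<in> sets borel"
  shows "emeasure M ((\<lambda>x. a + x) ` A) = emeasure M A"
  using assms(1) unfolding normalized_haar_measure_def
  by (elim conjE) (drule bspec[OF _ assms(2)], erule spec)

lemma haar_outer:
  assumes "normalized_haar_measure M" "A \<in> sets borel"
  shows "emeasure M A = (INF U\<in>{U. open U \<and> A \<subseteq> U}. emeasure M U)"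
  using assms(1) unfolding normalized_haar_measure_def
  by (elim conjE) (erule bspec[OF _ assms(2)])

lemma haar_inner:
  assumes "normalized_haar_measure M" "open U"
  shows "emeasure M U = (SUP K\<in>{K. compact K \<and> K \<subseteq> U}. emeasure M K)"
  using assms(1) unfolding normalized_haar_measure_def
  by (elim conjE) (drule spec, erule mp[OF _ assms(2)])

text \<open>Outer regularity gives an open U around B, inner regularity a compact K in U that nearly
  fills U (not B), and a Urysohn function a cozero set between K and U. The errors are summable, so
  by the first Borel-Cantelli lemma the limit inferior of these cozero sets agrees with B almost
  everywhere.\<close>

lemma borel_eq_baire_AE:
  fixes M :: "'a::{topological_ab_group_add,t2_space} measure"
  assumes comp: "compact (UNIV :: 'a set)" and M: "normalized_haar_measure M"
    and B: "B \<in> sets borel"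
  obtains B' where "B' \<in> sets baire" "AE x in M. x \<in> B \<longleftrightarrow> x \<in> B'"
proof -
  note sets_M = haar_sets[OF M] and outer = haar_outer[OF M B] and inner = haar_inner[OF M]
  interpret prob_space M by (rule haar_prob_space[OF M])
  have "\<exists>V\<in>cozero_sets. measure M ((B - V) \<union> (V - B)) \<le> 2 * (1/2) ^ j" for j :: nat
  proof -
    let ?e = "(1/2) ^ j :: real"
    have e: "?e > 0" by simp
    then have "emeasure M B < ennreal (measure M B + ?e)"
      unfolding emeasure_eq_measure by (intro ennreal_lessI add_nonneg_pos) auto
    then obtain U where U: "open U" "B \<subseteq> U" "emeasure M U < ennreal (measure M B + ?e)"
      unfolding outer INF_less_iff by blast
    from U(3) have UB: "measure M U < measure M B + ?e"
      unfolding emeasure_eq_measure by (subst (asm) ennreal_less_iff) auto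
    obtain K where K: "compact K" "K \<subseteq> U" "measure M U < measure M K + ?e"
    proof (cases "measure M U < ?e")
      \<comment> \<open>Here \<open>measure M U - ?e\<close> is negative and \<open>ennreal\<close>
        would truncate it to 0, so the empty set is used directly.\<close>
      case True
      then show thesis using that[of "{}"] by simp
    next
      case False
      then have "ennreal (measure M U - ?e) < emeasure M U"
        unfolding emeasure_eq_measure using e by (subst ennreal_less_iff) auto
      then obtain K where K: "compact K" "K \<subseteq> U" "ennreal (measure M U - ?e) < emeasure M K"
        unfolding inner[OF U(1)] less_SUP_iff by blast
      from K(3) have "measure M U - ?e < measure M K"
        unfolding emeasure_eq_measure using False by (subst (asm) ennreal_less_iff) auto
      then show thesis using K that[of K] by simp
    qed
    have [measurable]: "U \<in> sets M" "K \<in> sets M" "B \<in> sets M"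
      using U(1) compact_imp_closed[OF K(1)] B by (auto simp: sets_M)
    have "closed (- U)" "closed K" "- U \<inter> K = {}"
      using U(1) K(1,2) by (auto intro: compact_imp_closed)
    from Urysohn_compact[OF comp this]
    obtain g :: "'a \<Rightarrow> real" where g: "continuous_on UNIV g" "\<And>x. x \<in> - U \<Longrightarrow> g x = 0" "\<And>x. x \<in> K \<Longrightarrow> g x = 1"
      by metis
    define V where "V = {x. 0 < g x}"
    have V: "V \<in> cozero_sets" using g(1) by (auto simp: V_def cozero_sets_def)
    have KV: "K \<subseteq> V" using g(3) by (auto simp: V_def)
    have VU: "V \<subseteq> U" using g(2) by (metis ComplI V_def mem_Collect_eq order_less_irrefl subsetI)
    have "(B - V) \<union> (V - B) \<subseteq> (U - B) \<union> (U - K)" using KV VU U(2) by blast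
    then have "measure M ((B - V) \<union> (V - B)) \<le> measure M ((U - B) \<union> (U - K))"
      by (intro finite_measure_mono) measurable
    also have "\<dots> \<le> measure M (U - B) + measure M (U - K)"
      by (intro measure_Un_le) measurable
    also have "\<dots> = (measure M U - measure M B) + (measure M U - measure M K)"
      using U(2) K(2) by (simp add: finite_measure_Diff)
    also have "\<dots> \<le> 2 * ?e"
      using UB K(3) by simp
    finally show ?thesis using V by blast
  qed
  then obtain V where V: "\<And>j. V j \<in> cozero_sets" and le: "\<And>j. measure M ((B - V j) \<union> (V j - B)) \<le> 2 * (1/2) ^ j"
    by metis
  have V_baire: "V j \<in> sets baire" for j using V by (rule cozero_baire)
  have [measurable]: "B \<in> sets M" "V j \<in> sets M" for j
    using V_baire sets_baire_subset_borel B by (auto simp: sets_M)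
  have "AE x in M. eventually (\<lambda>j. x \<in> space M - ((B - V j) \<union> (V j - B))) sequentially"
  proof (rule borel_cantelli_AE1)
    show "summable (\<lambda>j. measure M ((B - V j) \<union> (V j - B)))"
      by (rule summable_comparison_test'[where g = "\<lambda>j. 2 * (1/2) ^ j" and N = 0])
        (use le in \<open>auto intro!: summable_mult summable_geometric\<close>)
  qed (auto simp: less_top[symmetric])
  then have AE: "AE x in M. x \<in> B \<longleftrightarrow> eventually (\<lambda>j. x \<in> V j) sequentially"
  proof eventually_elim
    case (elim x)
    then have "eventually (\<lambda>j. x \<in> B \<longleftrightarrow> x \<in> V j) sequentially" by eventually_elim blast
    then have "eventually (\<lambda>j. x \<in> V j) sequentially \<longleftrightarrow> eventually (\<lambda>j. x \<in> B) sequentially"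
      by (rule eventually_cong[symmetric]) simp
    then show ?case by simp
  qed
  show thesis
  proof (rule that)
    have "(\<Union>m. \<Inter>j\<in>{m..}. V j) \<in> sets baire" using V_baire by (intro sets.countable_UN sets.countable_INT) auto
    also have "(\<Union>m. \<Inter>j\<in>{m..}. V j) = {x. eventually (\<lambda>j. x \<in> V j) sequentially}"
      by (auto simp: eventually_sequentially)
    finally show "{x. eventually (\<lambda>j. x \<in> V j) sequentially} \<in> sets baire" .
    show "AE x in M. x \<in> B \<longleftrightarrow> x \<in> {x. eventually (\<lambda>j. x \<in> V j) sequentially}" using AE by simp
  qed
qed

text \<open>Chebyshev's inequality: the number X of events in a finite block J has mean s and, by
  pairwise independence, variance at most s. Hence X = 0 has probability at most 1 / s, and
  divergence makes s as large as desired.\<close>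

lemma (in prob_space) pairwise_borel_cantelli:
  assumes E[measurable]: "\<And>k. E k \<in> events"
    and indep: "\<And>k l. k \<noteq> l \<Longrightarrow> prob (E k \<inter> E l) = prob (E k) * prob (E l)"
    and div: "\<not> summable (\<lambda>k. prob (E k))"
  shows "AE x in M. \<exists>\<^sub>\<infinity>k. x \<in> E k"
proof -
  have null: "prob (\<Inter>k\<in>{m..}. space M - E k) \<le> 0" for m :: nat
  proof (rule field_le_epsilon)
    fix e :: real assume e: "e > 0"
    define Z where "Z = (\<Inter>k\<in>{m..}. space M - E k)"
    have Z[measurable]: "Z \<in> events" unfolding Z_def by (intro sets.countable_INT') auto
    have "\<not> summable (\<lambda>k. prob (E (k + m)))" using div summable_iff_shift[of "\<lambda>k. prob (E k)" m] by simp
    then have "\<exists>n. 1 / e < (\<Sum>k\<le>n. prob (E (k + m)))"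
      using bounded_imp_summable[of "\<lambda>k. prob (E (k + m))" "1 / e"]
      by (meson measure_nonneg not_le)
    then have "\<exists>N. 1 / e < (\<Sum>k<N. prob (E (k + m)))" unfolding lessThan_Suc_atMost[symmetric] by blast
    then obtain N where N: "1 / e < (\<Sum>k<N. prob (E (k + m)))" by blast
    define J where "J = {m..<N + m}"
    define s where "s = (\<Sum>k\<in>J. prob (E k))"
    have "s = (\<Sum>k<N. prob (E (k + m)))"
      unfolding s_def J_def using sum.shift_bounds_nat_ivl[of "\<lambda>k. prob (E k)" 0 m N]
      by (simp add: atLeast0LessThan)
    then have s: "1 / e < s" using N by simp
    then have s0: "s > 0" using e by (meson divide_pos_pos less_trans zero_less_one)
    define X where "X x = (\<Sum>k\<in>J. indicator (E k) x :: real)" for x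
    have X_int: "integrable M X" unfolding X_def by (intro Bochner_Integration.integrable_sum) (simp add: emeasure_eq_measure)
    have EX: "expectation X = s" unfolding X_def s_def by (subst Bochner_Integration.integral_sum) (auto simp: emeasure_eq_measure)
    have X2: "X x * X x = (\<Sum>k\<in>J. \<Sum>l\<in>J. indicator (E k \<inter> E l) x)" for x
      unfolding X_def sum_product by (simp add: indicator_inter_arith)
    have X2_int: "integrable M (\<lambda>x. X x * X x)"
      unfolding X2 by (intro Bochner_Integration.integrable_sum) (simp add: emeasure_eq_measure)
    have "expectation (\<lambda>x. X x * X x) = (\<Sum>k\<in>J. \<Sum>l\<in>J. prob (E k \<inter> E l))"
      unfolding X2 by (simp add: Bochner_Integration.integral_sum emeasure_eq_measure)
    \<comment> \<open>Independence settles k \<noteq> l; on the diagonal the extra summand alone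
      suffices.\<close>
    also have "\<dots> \<le> (\<Sum>k\<in>J. \<Sum>l\<in>J. prob (E k) * prob (E l) + (if k = l then prob (E k) else 0))"
      by (intro sum_mono) (auto simp: indep)
    also have "\<dots> = s * s + s"
      unfolding sum.distrib s_def sum_product by (simp add: sum.delta J_def)
    finally have EX2: "expectation (\<lambda>x. X x * X x) \<le> s * s + s" .
    have "s * s * prob Z = expectation (\<lambda>x. s * s * indicator Z x)" by (simp add: emeasure_eq_measure)
    \<comment> \<open>The right-hand integrand is (X - s)^2 expanded; on Z it equals s^2.\<close>
    also have "\<dots> \<le> expectation (\<lambda>x. X x * X x - 2 * s * X x + s * s)"
    proof (rule integral_mono)
      show "integrable M (\<lambda>x. s * s * indicator Z x)" by (simp add: emeasure_eq_measure)
      show "integrable M (\<lambda>x. X x * X x - 2 * s * X x + s * s)" using X_int X2_int by auto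
      fix x assume "x \<in> space M"
      show "s * s * indicator Z x \<le> X x * X x - 2 * s * X x + s * s"
      proof (cases "x \<in> Z")
        case True
        then have "X x = 0" unfolding X_def by (intro sum.neutral) (auto simp: Z_def J_def)
        then show ?thesis using True by simp
      next
        case False
        have "0 \<le> (X x - s)\<^sup>2" by simp
        then show ?thesis using False by (simp add: power2_eq_square algebra_simps)
      qed
    qed
    also have "\<dots> = expectation (\<lambda>x. X x * X x) - 2 * s * s + s * s"
      using X_int X2_int by (simp add: EX prob_space)
    also have "\<dots> \<le> s" using EX2 by simp
    finally have "prob Z * s \<le> 1" using s0 by (simp add: mult_ac)
    then have "prob Z \<le> 1 / s" using s0 by (simp add: field_simps)
    also have "1 / s \<le> e" using s e s0 by (simp add: field_simps)
    finally show "prob (\<Inter>k\<in>{m..}. space M - E k) \<le> 0 + e" by (simp add: Z_def)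
  qed
  have "AE x in M. x \<notin> (\<Inter>k\<in>{m..}. space M - E k)" for m :: nat
  proof (rule AE_not_in)
    show "(\<Inter>k\<in>{m..}. space M - E k) \<in> null_sets M"
      using null[of m] by (intro null_setsI sets.countable_INT')
        (auto simp: emeasure_eq_measure measure_le_0_iff)
  qed
  then have "AE x in M. \<forall>m :: nat. x \<notin> (\<Inter>k\<in>{m..}. space M - E k)" by (subst AE_all_countable) blast
  then show ?thesis
    using AE_space by eventually_elim (auto simp: INFM_nat_le)
qed

section \<open>Rotations by an open connected subgroup\<close>

text \<open>If K is least with \<bar>g x\<bar> \<le> C K, then x lies in \<open>B k\<close> for
  every k < K, including k = 0, so \<bar>g\<bar> is dominated by C times the sum of the
  indicators.\<close>

lemma summable_tail_imp_integrable:
  fixes g :: "'a \<Rightarrow> real"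
  assumes "finite_measure M" and g[measurable]: "g \<in> borel_measurable M" and C: "C \<ge> 1"
    and summ: "summable (\<lambda>k. measure M {x \<in> space M. real C * real k < \<bar>g x\<bar>})"
  shows "integrable M g"
proof (rule integrableI_bounded)
  interpret finite_measure M by fact
  define B where "B k = {x \<in> space M. real C * real k < \<bar>g x\<bar>}" for k :: nat
  have [measurable]: "B k \<in> sets M" for k unfolding B_def by measurable
  have "ennreal (norm (g x)) \<le> (\<Sum>k. ennreal C * indicator (B k) x)" if x: "x \<in> space M" for x
  proof -
    define K where "K = (LEAST K :: nat. \<bar>g x\<bar> \<le> real C * real K)"
    have "\<exists>K :: nat. \<bar>g x\<bar> \<le> real C * real K"
    proof -
      obtain K :: nat where "\<bar>g x\<bar> \<le> real K" using real_arch_simple by blast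
      also have "real K \<le> real C * real K" using C by (simp add: mult_le_cancel_right1)
      finally show ?thesis by blast
    qed
    then have K: "\<bar>g x\<bar> \<le> real C * real K" unfolding K_def by (rule LeastI_ex)
    have less: "x \<in> B k" if "k < K" for k
      using not_less_Least[OF that[unfolded K_def]] x by (simp add: B_def)
    have "ennreal (norm (g x)) \<le> ennreal (real C * real K)" using K by (intro ennreal_leI) simp
    also have "\<dots> = (\<Sum>k<K. ennreal C)" by (simp add: ennreal_mult mult.commute ennreal_of_nat_eq_real_of_nat)
    also have "\<dots> = (\<Sum>k<K. ennreal C * indicator (B k) x)" using less by (intro sum.cong) auto
    also have "\<dots> \<le> (\<Sum>k. ennreal C * indicator (B k) x)" by (intro sum_le_suminf) auto
    finally show ?thesis .
  qed
  then have "(\<integral>\<^sup>+x. ennreal (norm (g x)) \<partial>M) \<le> (\<integral>\<^sup>+x. (\<Sum>k. ennreal C * indicator (B k) x) \<partial>M)"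
    by (rule nn_integral_mono)
  also have "\<dots> = (\<Sum>k. ennreal C * emeasure M (B k))"
    by (subst nn_integral_suminf) (auto simp: nn_integral_cmult)
  also have "\<dots> = ennreal C * (\<Sum>k. ennreal (measure M (B k)))"
    by (simp add: ennreal_suminf_cmult emeasure_eq_measure)
  also have "\<dots> = ennreal C * ennreal (\<Sum>k. measure M (B k))"
    using summ by (subst suminf_ennreal2) (auto simp: B_def)
  also have "\<dots> < \<infinity>" by (simp add: ennreal_mult_less_top)
  finally show "(\<integral>\<^sup>+x. ennreal (norm (g x)) \<partial>M) < \<infinity>" .
qed (rule g)

text \<open>Integer constants C suffice to refute a finite limsup, so only countably many
  almost-everywhere statements have to be combined.\<close>

lemma limsup_quotient_infinite:
  assumes "\<And>C :: nat. C \<ge> 1 \<Longrightarrow> \<exists>\<^sub>\<infinity>k. real C * real k < \<bar>u k :: real\<bar>"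
  shows "\<not> limsup (\<lambda>k. ereal (\<bar>u k\<bar> / real k)) < \<infinity>"
proof
  assume "limsup (\<lambda>k. ereal (\<bar>u k\<bar> / real k)) < \<infinity>"
  then obtain r :: real where "limsup (\<lambda>k. ereal (\<bar>u k\<bar> / real k)) < ereal r"
    using less_PInf_Ex_of_nat by fastforce
  then have ev: "eventually (\<lambda>k. ereal (\<bar>u k\<bar> / real k) < ereal r) sequentially" by (rule Limsup_lessD)
  obtain C :: nat where C: "C \<ge> 1" "r \<le> real C"
    using real_arch_simple[of "max r 1"] by (metis max.bounded_iff of_nat_1 of_nat_le_iff)
  obtain N where N: "\<And>k. k \<ge> N \<Longrightarrow> \<bar>u k\<bar> / real k < r"
    using ev by (auto simp: eventually_sequentially)
  \<comment> \<open>Requiring k \<ge> 1 avoids the quotient by 0, whose value is 0.\<close>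
  obtain k where k: "k \<ge> max N 1" "real C * real k < \<bar>u k\<bar>"
    using assms[OF C(1)] unfolding INFM_nat_le by blast
  then have "real C < \<bar>u k\<bar> / real k" by (simp add: field_simps)
  also have "\<dots> < r" using N k by simp
  finally show False using C by simp
qed

locale haar_subgroup = compact_connected_subgroup H
  for H :: "'a::{topological_ab_group_add,t2_space} set" +
  fixes M :: "'a measure"
  assumes haar: "normalized_haar_measure M" and open_H: "open H"
begin

sublocale prob_space M
  by (rule haar_prob_space[OF haar])

lemma sets_M: "sets M = sets borel"
  by (rule haar_sets[OF haar])

lemma space_M: "space M = UNIV"
  by (rule haar_space[OF haar])

lemma shift_sets: "A \<in> sets borel \<Longrightarrow> {x :: 'a. x + a \<in> A} \<in> sets borel"
proof -
  assume A: "A \<in> sets borel"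
  have "(\<lambda>x :: 'a. x + a) \<in> borel_measurable borel"
    by (intro borel_measurable_continuous_onI continuous_intros)
  from measurable_sets[OF this A] show ?thesis by (simp add: vimage_def)
qed

lemma emeasure_shift: "A \<in> sets borel \<Longrightarrow> emeasure M {x. x + a \<in> A} = emeasure M A"
proof -
  assume A: "A \<in> sets borel"
  have eq: "{x. x + a \<in> A} = (\<lambda>x. - a + x) ` A"
    by (auto simp: image_iff) (metis add.commute add_diff_cancel uminus_add_conv_diff)
  show ?thesis unfolding eq by (rule haar_translate[OF haar A])
qed

lemma AE_shift:
  assumes "AE x in M. P x"
  shows "AE x in M. P (x + a)"
proof -
  obtain N where N: "{x \<in> space M. \<not> P x} \<subseteq> N" "emeasure M N = 0" "N \<in> sets M"
    using assms by (rule AE_E)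
  show ?thesis
  proof (rule AE_I)
    show "{x \<in> space M. \<not> P (x + a)} \<subseteq> {x. x + a \<in> N}" using N(1) by (auto simp: space_M)
    show "emeasure M {x. x + a \<in> N} = 0" using emeasure_shift[of N a] N by (simp add: sets_M)
    show "{x. x + a \<in> N} \<in> sets M" using shift_sets[of N a] N by (simp add: sets_M)
  qed
qed

lemma H_borel: "H \<in> sets borel"
  using open_H by simp

lemma finite_cosets:
  obtains D where "finite D" "\<And>x. \<exists>\<delta>\<in>D. x - \<delta> \<in> H"
proof -
  obtain D where "D \<subseteq> UNIV" "finite D" "UNIV \<subseteq> (\<Union>\<delta>\<in>D. (\<lambda>x. x - \<delta>) -` H)"
  proof (rule compactE_image[OF compact_UNIV, of UNIV "\<lambda>\<delta>. (\<lambda>x. x - \<delta>) -` H"])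
    show "open ((\<lambda>x. x - \<delta>) -` H)" for \<delta> using open_H by (intro open_vimage continuous_intros)
    show "UNIV \<subseteq> (\<Union>\<delta>\<in>UNIV. (\<lambda>x. x - \<delta>) -` H)" using zero_mem by auto
  qed
  then show thesis by (intro that[of D]) auto
qed

text \<open>B is cut along the cosets of the elements \<delta> + a, and each piece is translated
  back into H. The free shift a lets one set D serve all multiples of \<beta> later.\<close>

lemma emeasure_coset_le:
  assumes "finite D" "\<And>x. \<exists>\<delta>\<in>D. x - \<delta> \<in> H" and B: "B \<in> sets borel"
  shows "emeasure M B \<le> (\<Sum>\<delta>\<in>D. emeasure M (H \<inter> {x. x + (\<delta> + a) \<in> B}))"
proof -
  define P where "P \<delta> = {x. x + - (\<delta> + a) \<in> H} \<inter> B" for \<delta>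
  have P: "P \<delta> \<in> sets borel" for \<delta> unfolding P_def using shift_sets[OF H_borel] B by blast
  have "B \<subseteq> (\<Union>\<delta>\<in>D. P \<delta>)"
  proof
    fix x assume "x \<in> B"
    moreover obtain \<delta> where "\<delta> \<in> D" "(x - a) - \<delta> \<in> H" using assms(2) by blast
    ultimately show "x \<in> (\<Union>\<delta>\<in>D. P \<delta>)" by (auto simp: P_def algebra_simps)
  qed
  then have "emeasure M B \<le> emeasure M (\<Union>\<delta>\<in>D. P \<delta>)"
    using P assms(1) by (intro emeasure_mono) (auto simp: sets_M)
  also have "\<dots> \<le> (\<Sum>\<delta>\<in>D. emeasure M (P \<delta>))"
    using P assms(1) by (intro emeasure_subadditive_finite) (auto simp: sets_M)
  also have "\<dots> = (\<Sum>\<delta>\<in>D. emeasure M (H \<inter> {x. x + (\<delta> + a) \<in> B}))"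
  proof (intro sum.cong refl)
    fix \<delta>
    have "emeasure M (P \<delta>) = emeasure M {x. x + (\<delta> + a) \<in> P \<delta>}" by (rule emeasure_shift[OF P, symmetric])
    also have "{x. x + (\<delta> + a) \<in> P \<delta>} = H \<inter> {x. x + (\<delta> + a) \<in> B}" by (auto simp: P_def)
    finally show "emeasure M (P \<delta>) = emeasure M (H \<inter> {x. x + (\<delta> + a) \<in> B})" .
  qed
  finally show ?thesis .
qed

lemma emeasure_H_pos: "emeasure M H \<noteq> 0"
proof
  assume 0: "emeasure M H = 0"
  obtain D where "finite D" "\<And>x. \<exists>\<delta>\<in>D. x - \<delta> \<in> H" by (rule finite_cosets) blast
  from emeasure_coset_le[OF this, of UNIV 0] 0 have "emeasure M UNIV \<le> 0" by simp
  then show False using emeasure_space_1 by (simp add: space_M)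
qed

text \<open>Normalized Haar measure of H, kept as a measure on the whole group; membership in H
  becomes an almost-everywhere fact.\<close>

definition \<nu> :: "'a measure" where "\<nu> = uniform_measure M H"

lemma sets_\<nu> [simp, measurable_cong]: "sets \<nu> = sets borel"
  by (simp add: \<nu>_def sets_M)

lemma space_\<nu> [simp]: "space \<nu> = UNIV"
  by (simp add: \<nu>_def space_M)

lemma prob_space_\<nu>: "prob_space \<nu>"
  unfolding \<nu>_def using emeasure_H_pos by (intro prob_space_uniform_measure) auto

sublocale \<nu>: prob_space \<nu>
  by (rule prob_space_\<nu>)

sublocale \<nu>\<nu>: pair_prob_space \<nu> \<nu> ..

lemma AE_\<nu>: "(AE x in M. x \<in> H \<longrightarrow> P x) \<longleftrightarrow> (AE x in \<nu>. P x)"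
  unfolding \<nu>_def using emeasure_H_pos H_borel
  by (intro AE_uniform_measure[symmetric]) (auto simp: less_top[symmetric])

lemma AE_\<nu>_I: "AE x in M. P x \<Longrightarrow> AE x in \<nu>. P x"
  unfolding AE_\<nu>[symmetric] by auto

lemma AE_\<nu>_H: "AE x in \<nu>. x \<in> H"
  unfolding AE_\<nu>[symmetric] by auto

lemma emeasure_\<nu>: "A \<in> sets borel \<Longrightarrow> emeasure \<nu> A = emeasure M (H \<inter> A) / emeasure M H"
  unfolding \<nu>_def using H_borel by (simp add: sets_M)

lemma emeasure_\<nu>_shift:
  assumes "h \<in> H" "A \<in> sets borel"
  shows "emeasure \<nu> {x. x + h \<in> A} = emeasure \<nu> A"
proof -
  have "H \<inter> {x. x + h \<in> A} = {x. x + h \<in> H \<inter> A}"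
    using add_mem_cancel[OF assms(1)] by (auto simp: add.commute)
  moreover have "emeasure M {x. x + h \<in> H \<inter> A} = emeasure M (H \<inter> A)"
    by (intro emeasure_shift sets.Int H_borel assms)
  ultimately show ?thesis
    using assms(2) by (simp only: emeasure_\<nu> shift_sets)
qed

lemma sum_measurable_baire:
  "(\<lambda>(\<gamma>, x). x + int_mult k \<gamma>) \<in> measurable (\<nu> \<Otimes>\<^sub>M \<nu>) baire"
proof -
  have "(\<lambda>p :: 'a \<times> 'a. snd p + int_mult k (fst p)) \<in> measurable (borel \<Otimes>\<^sub>M borel) baire"
    by (intro continuous_product_measurable_baire compact_UNIV continuous_intros)
  moreover have "measurable (\<nu> \<Otimes>\<^sub>M \<nu>) baire = measurable (borel \<Otimes>\<^sub>M borel) (baire :: 'a measure)"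
    by (intro measurable_cong_sets sets_pair_measure_cong) simp_all
  ultimately show ?thesis by (simp add: split_beta)
qed

lemma sum_sets:
  assumes "B \<in> sets baire"
  shows "{(\<gamma>, x). x + int_mult k \<gamma> \<in> B} \<in> sets (\<nu> \<Otimes>\<^sub>M \<nu>)"
  using measurable_sets[OF sum_measurable_baire assms, of k]
  by (simp add: space_pair_measure vimage_def case_prod_unfold)

text \<open>Multiplication by \<open>p\<close> maps \<open>H\<close> onto itself, so both \<open>\<nu>\<close> and its image are invariant
  under \<open>H\<close>; the proof is the usual uniqueness argument for Haar measure.\<close>

lemma emeasure_\<nu>_int_mult:
  assumes p: "p \<noteq> 0" and x: "x \<in> H" and B: "B \<in> sets baire"
  shows "emeasure \<nu> {\<gamma>. x + int_mult p \<gamma> \<in> B} = emeasure \<nu> B"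
proof -
  let ?Q = "{(\<gamma>, y). y + int_mult p \<gamma> \<in> B}"
  have Bb: "B \<in> sets borel" using B sets_baire_subset_borel by blast
  have Q: "?Q \<in> sets (\<nu> \<Otimes>\<^sub>M \<nu>)" by (rule sum_sets[OF B])
  have Qs: "{\<gamma>. y + int_mult p \<gamma> \<in> B} \<in> sets borel" for y
    using sets_Pair2[OF Q, of y] by (simp add: vimage_def)
  \<comment> \<open>Integrating over y first, invariance of \<nu> under H gives the measure of
    B.\<close>
  have "emeasure (\<nu> \<Otimes>\<^sub>M \<nu>) ?Q = (\<integral>\<^sup>+\<gamma>. emeasure \<nu> {y. y + int_mult p \<gamma> \<in> B} \<partial>\<nu>)"
    using \<nu>.emeasure_pair_measure_alt[OF Q] by (simp add: vimage_def)
  also have "\<dots> = (\<integral>\<^sup>+\<gamma>. emeasure \<nu> B \<partial>\<nu>)"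
    by (intro nn_integral_cong_AE eventually_mono[OF AE_\<nu>_H] emeasure_\<nu>_shift int_mult_mem Bb)
  finally have 1: "emeasure (\<nu> \<Otimes>\<^sub>M \<nu>) ?Q = emeasure \<nu> B"
    using \<nu>.emeasure_space_1 by simp
  \<comment> \<open>Integrating over \<gamma> first, the inner value is constant on H. Divisibility
    enters here: the difference y - x is p h, and \<nu> is invariant under h.\<close>
  have const: "emeasure \<nu> {\<gamma>. y + int_mult p \<gamma> \<in> B} = emeasure \<nu> {\<gamma>. x + int_mult p \<gamma> \<in> B}" if y: "y \<in> H" for y
  proof -
    obtain h where h: "h \<in> H" "int_mult p h = y - x" using divisible[OF p diff_mem[OF y x]] .
    have "{\<gamma>. y + int_mult p \<gamma> \<in> B} = {\<gamma>. \<gamma> + h \<in> {\<gamma>. x + int_mult p \<gamma> \<in> B}}"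
      by (simp add: int_mult_add_right h algebra_simps)
    then show ?thesis using emeasure_\<nu>_shift[OF h(1) Qs] by simp
  qed
  have "emeasure (\<nu> \<Otimes>\<^sub>M \<nu>) ?Q = (\<integral>\<^sup>+y. emeasure \<nu> {\<gamma>. y + int_mult p \<gamma> \<in> B} \<partial>\<nu>)"
    using \<nu>\<nu>.emeasure_pair_measure_alt2[OF Q] by (simp add: vimage_def)
  also have "\<dots> = (\<integral>\<^sup>+y. emeasure \<nu> {\<gamma>. x + int_mult p \<gamma> \<in> B} \<partial>\<nu>)"
    by (intro nn_integral_cong_AE eventually_mono[OF AE_\<nu>_H] const)
  finally show ?thesis using 1 \<nu>.emeasure_space_1 by simp
qed

text \<open>For fixed \<gamma>, translating x by the k-th multiple reduces to k = 0. Then the first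
  condition involves x only, and for fixed x in H the second has probability \<nu>(B) by
  \<open>emeasure_\<nu>_int_mult\<close>.\<close>

lemma pairwise_independent:
  assumes kl: "k \<noteq> l" and A: "A \<in> sets baire" and B: "B \<in> sets baire"
  shows "emeasure (\<nu> \<Otimes>\<^sub>M \<nu>) ({(\<gamma>, x). x + int_mult k \<gamma> \<in> A} \<inter> {(\<gamma>, x). x + int_mult l \<gamma> \<in> B})
    = emeasure \<nu> A * emeasure \<nu> B"
proof -
  let ?E = "{(\<gamma>, x). x + int_mult k \<gamma> \<in> A} \<inter> {(\<gamma>, x). x + int_mult l \<gamma> \<in> B}"
  let ?F = "{(\<gamma>, x). x + int_mult 0 \<gamma> \<in> A} \<inter> {(\<gamma>, x). x + int_mult (l - k) \<gamma> \<in> B}"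
  have E: "?E \<in> sets (\<nu> \<Otimes>\<^sub>M \<nu>)" and F: "?F \<in> sets (\<nu> \<Otimes>\<^sub>M \<nu>)"
    by (intro sets.Int sum_sets A B)+
  have Ab: "A \<in> sets borel" using A sets_baire_subset_borel by blast
  have "emeasure (\<nu> \<Otimes>\<^sub>M \<nu>) ?E = (\<integral>\<^sup>+\<gamma>. emeasure \<nu> (Pair \<gamma> -` ?E) \<partial>\<nu>)"
    by (rule \<nu>.emeasure_pair_measure_alt[OF E])
  also have "\<dots> = (\<integral>\<^sup>+\<gamma>. emeasure \<nu> (Pair \<gamma> -` ?F) \<partial>\<nu>)"
  proof (rule nn_integral_cong_AE, rule eventually_mono[OF AE_\<nu>_H])
    fix \<gamma> assume \<gamma>: "\<gamma> \<in> H"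
    have eq: "Pair \<gamma> -` ?E = {x. x + int_mult k \<gamma> \<in> Pair \<gamma> -` ?F}"
      by (auto simp: int_mult_diff_left)
    show "emeasure \<nu> (Pair \<gamma> -` ?E) = emeasure \<nu> (Pair \<gamma> -` ?F)"
      unfolding eq using sets_Pair1[OF F, of \<gamma>]
      by (intro emeasure_\<nu>_shift int_mult_mem \<gamma>) (simp only: sets_\<nu>)
  qed
  also have "\<dots> = emeasure (\<nu> \<Otimes>\<^sub>M \<nu>) ?F"
    by (rule \<nu>.emeasure_pair_measure_alt[OF F, symmetric])
  also have "\<dots> = (\<integral>\<^sup>+x. emeasure \<nu> ((\<lambda>\<gamma>. (\<gamma>, x)) -` ?F) \<partial>\<nu>)"
    by (rule \<nu>\<nu>.emeasure_pair_measure_alt2[OF F])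
  also have "\<dots> = (\<integral>\<^sup>+x. emeasure \<nu> B * indicator A x \<partial>\<nu>)"
  proof (rule nn_integral_cong_AE, rule eventually_mono[OF AE_\<nu>_H])
    fix x assume x: "x \<in> H"
    show "emeasure \<nu> ((\<lambda>\<gamma>. (\<gamma>, x)) -` ?F) = emeasure \<nu> B * indicator A x"
      using emeasure_\<nu>_int_mult[OF _ x B, of "l - k"] kl by (cases "x \<in> A") (simp_all add: vimage_def)
  qed
  also have "\<dots> = emeasure \<nu> A * emeasure \<nu> B"
    using Ab by (subst nn_integral_cmult_indicator) (auto simp: mult.commute)
  finally show ?thesis .
qed

lemma sum_prob:
  assumes "A \<in> sets baire"
  shows "emeasure (\<nu> \<Otimes>\<^sub>M \<nu>) {(\<gamma>, x). x + int_mult k \<gamma> \<in> A} = emeasure \<nu> A"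
  using pairwise_independent[of k "k + 1" A UNIV] assms \<nu>.emeasure_space_1 sets.top[of baire] by simp

text \<open>The targets \<open>A k\<close> may vary with k, which absorbs both the growing
  thresholds and the translations by multiples of \<beta>. All the points depend on the same two
  variables, so only pairwise independence is used.\<close>

lemma translates_infinitely_often:
  fixes n :: "nat \<Rightarrow> int"
  assumes n: "inj n" and A: "\<And>k. A k \<in> sets baire"
    and div: "\<not> summable (\<lambda>k. measure \<nu> (A k))"
  shows "AE \<gamma> in \<nu>. AE x in \<nu>. \<exists>\<^sub>\<infinity>k. x + int_mult (n k) \<gamma> \<in> A k"
proof -
  let ?E = "\<lambda>k. {(\<gamma>, x). x + int_mult (n k) \<gamma> \<in> A k}"
  have "AE p in \<nu> \<Otimes>\<^sub>M \<nu>. \<exists>\<^sub>\<infinity>k. p \<in> ?E k"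
  proof (rule \<nu>\<nu>.pairwise_borel_cantelli)
    show "?E k \<in> sets (\<nu> \<Otimes>\<^sub>M \<nu>)" for k by (rule sum_sets[OF A])
    have prob: "\<nu>\<nu>.prob (?E k) = measure \<nu> (A k)" for k
      unfolding measure_def using sum_prob[OF A] by simp
    show "\<not> summable (\<lambda>k. \<nu>\<nu>.prob (?E k))" unfolding prob by (rule div)
    show "\<nu>\<nu>.prob (?E k \<inter> ?E l) = \<nu>\<nu>.prob (?E k) * \<nu>\<nu>.prob (?E l)" if "k \<noteq> l" for k l
      unfolding prob unfolding measure_def using pairwise_independent[of "n k" "n l", OF _ A A] that n
      by (simp add: inj_eq enn2real_mult)
  qed
  from \<nu>\<nu>.AE_pair[OF this] show ?thesis by simp
qed

text \<open>Membership of \<alpha> = \<beta> + \<gamma> is refuted on a single coset \<delta> + H: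
  there, for almost every \<gamma>, the quotients are unbounded at almost every point, and the coset
  has positive measure.\<close>

lemma Gamma_coset_null:
  fixes n :: "nat \<Rightarrow> int"
  assumes n: "inj n" and g: "g \<in> borel_measurable borel" and fg: "AE x in M. f x = g x"
    and nint: "\<not> integrable M g"
  shows "AE \<alpha> in M. \<alpha> - \<beta> \<in> H \<longrightarrow> \<alpha> \<notin> Gamma_b (completion M) n f"
proof -
  define B where "B C k = {x. real C * real k < \<bar>g x\<bar>}" for C k :: nat
  have B[measurable]: "B C k \<in> sets borel" for C k unfolding B_def using g by measurable
  have B_mono: "B C k \<subseteq> B C' k" if "C' \<le> C" for C C' k
  proof -
    have "real C' * real k \<le> real C * real k" using that by (intro mult_right_mono) auto
    then show ?thesis by (auto simp: B_def)
  qed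
  have "\<exists>B'. B' \<in> sets baire \<and> (AE x in M. x \<in> B C k \<longleftrightarrow> x \<in> B')" for C k
    by (rule borel_eq_baire_AE[OF compact_UNIV haar B]) blast
  then obtain B' where B': "\<And>C k. B' C k \<in> sets baire"
    and AE_B': "\<And>C k. AE x in M. x \<in> B C k \<longleftrightarrow> x \<in> B' C k" by metis
  \<comment> \<open>At time k the point x + \<delta> +
    \<open>int_mult (n k) (\<beta> + \<gamma>)\<close> is the moving point x +
    \<open>int_mult (n k) \<gamma>\<close> of H displaced by \<open>e \<delta> k\<close>.\<close>
  define e where "e \<delta> k = \<delta> + int_mult (n k) \<beta>" for \<delta> k
  define a where "a \<delta> C k = measure \<nu> {x. x + e \<delta> k \<in> B C k}" for \<delta> C k
  obtain D where D: "finite D" "\<And>x. \<exists>\<delta>\<in>D. x - \<delta> \<in> H" by (rule finite_cosets) blast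
  have le_a: "measure M (B C k) \<le> (\<Sum>\<delta>\<in>D. a \<delta> C k)" for C k
  proof -
    have "emeasure M (B C k) \<le> (\<Sum>\<delta>\<in>D. emeasure M (H \<inter> {x. x + e \<delta> k \<in> B C k}))"
      unfolding e_def by (rule emeasure_coset_le[OF D B])
    also have "\<dots> \<le> (\<Sum>\<delta>\<in>D. emeasure \<nu> {x. x + e \<delta> k \<in> B C k})"
    proof (intro sum_mono)
      fix \<delta>
      \<comment> \<open>Conditioning on H divides by a number at most 1, so it can only enlarge the
        measure.\<close>
      have "measure M (H \<inter> {x. x + e \<delta> k \<in> B C k}) \<le> measure M (H \<inter> {x. x + e \<delta> k \<in> B C k}) / measure M H"
        using emeasure_H_pos by (simp add: emeasure_eq_measure pos_le_divide_eq zero_less_measure_iff mult_left_le)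
      then show "emeasure M (H \<inter> {x. x + e \<delta> k \<in> B C k}) \<le> emeasure \<nu> {x. x + e \<delta> k \<in> B C k}"
        using emeasure_H_pos by (simp add: emeasure_\<nu>[OF shift_sets[OF B]] emeasure_eq_measure
          divide_ennreal zero_less_measure_iff ennreal_leI)
    qed
    finally show ?thesis
      by (simp add: emeasure_eq_measure \<nu>.emeasure_eq_measure a_def sum_nonneg)
  qed
  \<comment> \<open>One \<delta> works for all C: otherwise each \<delta> has a bad constant, the
    sets shrink as C grows, and the maximum of these finitely many constants makes the whole tail
    sum converge, so that g would be integrable.\<close>
  have "\<exists>\<delta>\<in>D. \<forall>C\<ge>1. \<not> summable (a \<delta> C)"
  proof (rule ccontr)
    assume "\<not> ?thesis"
    then obtain C where C: "\<And>\<delta>. \<delta> \<in> D \<Longrightarrow> C \<delta> \<ge> 1 \<and> summable (a \<delta> (C \<delta>))" by metis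
    define C' where "C' = Max (insert 1 (C ` D))"
    have C'_ge: "C' \<ge> 1" "\<delta> \<in> D \<Longrightarrow> C \<delta> \<le> C'" for \<delta> unfolding C'_def using D(1) by auto
    have "summable (a \<delta> C')" if \<delta>: "\<delta> \<in> D" for \<delta>
    proof (rule summable_comparison_test'[where g = "a \<delta> (C \<delta>)" and N = 0])
      show "summable (a \<delta> (C \<delta>))" using C \<delta> by blast
      show "norm (a \<delta> C' k) \<le> a \<delta> (C \<delta>) k" for k
        using B_mono[OF C'_ge(2)[OF \<delta>], of k] shift_sets[OF B]
        by (auto simp: a_def intro!: \<nu>.finite_measure_mono)
    qed
    then have "summable (\<lambda>k. \<Sum>\<delta>\<in>D. a \<delta> C' k)" by (intro summable_sum)
    then have "summable (\<lambda>k. measure M (B C' k))"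
      by (rule summable_comparison_test'[where N = 0]) (use le_a in auto)
    then have "summable (\<lambda>k. measure M {x \<in> space M. real C' * real k < \<bar>g x\<bar>})"
      by (simp add: B_def space_M)
    moreover have "g \<in> borel_measurable M" using g measurable_cong_sets[OF sets_M refl] by blast
    ultimately have "integrable M g"
      using C'_ge(1) by (intro summable_tail_imp_integrable[OF finite_measure_axioms, of g C'])
    with nint show False by contradiction
  qed
  then obtain \<delta> where \<delta>: "\<And>C. C \<ge> 1 \<Longrightarrow> \<not> summable (a \<delta> C)" by blast
  define A where "A C k = {x. x + e \<delta> k \<in> B' C k}" for C k
  have A: "A C k \<in> sets baire" for C k
  proof -
    have "(\<lambda>x. x + e \<delta> k) \<in> measurable baire baire"
      by (intro continuous_measurable_baire_baire continuous_intros)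
    from measurable_sets[OF this B'] show ?thesis by (simp add: A_def vimage_def)
  qed
  have a_eq: "a \<delta> C k = measure \<nu> (A C k)" for C k
    unfolding a_def A_def
  proof (rule measure_eq_AE)
    show "AE x in \<nu>. x \<in> {x. x + e \<delta> k \<in> B C k} \<longleftrightarrow> x \<in> {x. x + e \<delta> k \<in> B' C k}"
      using AE_\<nu>_I[OF AE_shift[OF AE_B']] by simp
    show "{x. x + e \<delta> k \<in> B C k} \<in> sets \<nu>" using shift_sets[OF B] by simp
    show "{x. x + e \<delta> k \<in> B' C k} \<in> sets \<nu>" using A[of C k] sets_baire_subset_borel by (auto simp: A_def)
  qed
  have "AE \<gamma> in \<nu>. \<forall>C\<in>{1..}. AE x in \<nu>. \<exists>\<^sub>\<infinity>k. x + int_mult (n k) \<gamma> \<in> A C k"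
  proof (intro AE_ball_countable[THEN iffD2] ballI)
    fix C :: nat assume "C \<in> {1..}"
    then have "\<not> summable (\<lambda>k. measure \<nu> (A C k))" using \<delta>[of C] by (simp flip: a_eq)
    then show "AE \<gamma> in \<nu>. AE x in \<nu>. \<exists>\<^sub>\<infinity>k. x + int_mult (n k) \<gamma> \<in> A C k"
      by (rule translates_infinitely_often[OF n A])
  qed simp
  then have "AE \<gamma> in \<nu>. \<beta> + \<gamma> \<notin> Gamma_b (completion M) n f"
  proof eventually_elim
    case (elim \<gamma>)
    then have io: "AE x in \<nu>. \<forall>C\<in>{1..}. \<exists>\<^sub>\<infinity>k. x + int_mult (n k) \<gamma> \<in> A C k"
      by (intro AE_ball_countable[THEN iffD2]) auto
    let ?y = "\<lambda>x k. x + \<delta> + int_mult (n k) (\<beta> + \<gamma>)"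
    show ?case
    proof
      assume "\<beta> + \<gamma> \<in> Gamma_b (completion M) n f"
      then have "AE x in M. limsup (\<lambda>k. ereal (\<bar>f (x + int_mult (n k) (\<beta> + \<gamma>))\<bar> / real k)) < \<infinity>"
        by (simp add: Gamma_b_def AE_completion_iff)
      from AE_\<nu>_I[OF AE_shift[OF this, of \<delta>]]
      have lim: "AE x in \<nu>. limsup (\<lambda>k. ereal (\<bar>f (?y x k)\<bar> / real k)) < \<infinity>" .
      \<comment> \<open>Only countably many translates occur, so the exceptional null sets for f =
        g, and likewise for \<open>B\<close> and \<open>B'\<close>, can be united.\<close>
      have "AE x in M. f (?y x k) = g (?y x k)" for k
        using AE_shift[OF fg, of "\<delta> + int_mult (n k) (\<beta> + \<gamma>)"] by (simp add: add.assoc)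
      then have fg': "AE x in \<nu>. \<forall>k. f (?y x k) = g (?y x k)"
        by (intro AE_\<nu>_I) (simp add: AE_all_countable)
      have "AE x in M. ?y x k \<in> B C k \<longleftrightarrow> ?y x k \<in> B' C k" for C k
        using AE_shift[OF AE_B', of "\<delta> + int_mult (n k) (\<beta> + \<gamma>)"] by (simp add: add.assoc)
      then have BB': "AE x in \<nu>. \<forall>C k. ?y x k \<in> B C k \<longleftrightarrow> ?y x k \<in> B' C k"
        by (intro AE_\<nu>_I) (simp add: AE_all_countable)
      have "AE x in \<nu>. False"
        using io lim fg' BB'
      proof eventually_elim
        case (elim x)
        have eq: "x + int_mult (n k) \<gamma> + e \<delta> k = ?y x k" for k
          by (simp add: e_def int_mult_add_right add_ac)
        have "\<exists>\<^sub>\<infinity>k. real C * real k < \<bar>f (?y x k)\<bar>" if "C \<ge> 1" for C :: nat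
        proof -
          have "\<exists>\<^sub>\<infinity>k. x + int_mult (n k) \<gamma> \<in> A C k" using elim(1) that by simp
          then show ?thesis
            by (rule INFM_mono) (use elim(3,4) in \<open>simp add: A_def eq B_def\<close>)
        qed
        from limsup_quotient_infinite[OF this] elim(2) show False by blast
      qed
      then show False by (simp add: \<nu>.AE_const)
    qed
  qed
  then have "AE \<gamma> in M. \<gamma> \<in> H \<longrightarrow> \<beta> + \<gamma> \<notin> Gamma_b (completion M) n f" unfolding AE_\<nu> .
  from AE_shift[OF this, of "- \<beta>"] show ?thesis by simp
qed

end

text \<open>For y in the component of 0, its translate by -y is connected and contains 0, hence
  stays inside; this gives closure under differences.\<close>

lemma compact_connected_subgroup_component:
  assumes "compact (UNIV :: 'a::{topological_ab_group_add,t2_space} set)"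
  shows "compact_connected_subgroup (connected_component_set UNIV (0 :: 'a))"
proof
  let ?H = "connected_component_set UNIV (0 :: 'a)"
  show "compact (UNIV :: 'a set)" by fact
  have "closed ?H" by (intro closed_connected_component) simp
  then show "compact ?H" using compact_Int_closed[OF assms] by simp
  show "connected ?H" by simp
  show zero: "0 \<in> ?H" by simp
  fix x y assume xy: "x \<in> ?H" "y \<in> ?H"
  have "connected ((\<lambda>z. z - y) ` ?H)"
    by (intro connected_continuous_image continuous_intros) simp
  moreover have "0 \<in> (\<lambda>z. z - y) ` ?H" using xy(2) by (intro image_eqI[of _ _ y]) auto
  ultimately have "(\<lambda>z. z - y) ` ?H \<subseteq> ?H" by (intro connected_component_maximal) auto
  then show "x - y \<in> ?H" using xy(1) by blast
qed

theorem theorem1: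
  fixes n :: "nat \<Rightarrow> int"
    and M :: "'a::{topological_ab_group_add,t2_space} measure"
    and f :: "'a \<Rightarrow> real"
  assumes "strict_mono n"
    and "compact (UNIV :: 'a set)"
    and "locally connected (UNIV :: 'a set)"
    and "normalized_haar_measure M"
    and "f \<in> borel_measurable (completion M)"
    and "emeasure (completion M) (Gamma_b (completion M) n f) > 0"
  shows "integrable (completion M) f"
proof (rule ccontr)
  assume nint: "\<not> integrable (completion M) f"
  define H where "H = connected_component_set UNIV (0 :: 'a)"
  have "openin (top_of_set UNIV) H"
    unfolding H_def by (rule openin_connected_component_locally_connected[OF assms(3)])
  then have "open H" by simp
  interpret compact_connected_subgroup H
    unfolding H_def by (rule compact_connected_subgroup_component[OF assms(2)])
  interpret haar_subgroup H M
    by unfold_locales (fact assms(4), fact)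
  obtain g where g: "g \<in> borel_measurable M" "AE x in M. f x = g x"
    using completion_ex_borel_measurable_real[OF assms(5)] by blast
  have "\<not> integrable M g"
  proof
    assume "integrable M g"
    then have "integrable (completion M) g" using g(1) by (simp add: integrable_completion)
    moreover have "integrable (completion M) f \<longleftrightarrow> integrable (completion M) g"
      by (intro integrable_cong_AE assms(5) measurable_completion g(1) AE_completion g(2))
    ultimately show False using nint by blast
  qed
  moreover have "g \<in> borel_measurable borel" using g(1) measurable_cong_sets[OF sets_M refl] by blast
  ultimately have coset: "AE \<alpha> in M. \<alpha> - \<beta> \<in> H \<longrightarrow> \<alpha> \<notin> Gamma_b (completion M) n f" for \<beta>
    using Gamma_coset_null[OF strict_mono_imp_inj_on[OF assms(1)] _ g(2)] by blast
  obtain D where D: "finite D" "\<And>x. \<exists>\<delta>\<in>D. x - \<delta> \<in> H" by (rule finite_cosets) blast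
  have "AE \<alpha> in M. \<forall>\<beta>\<in>D. \<alpha> - \<beta> \<in> H \<longrightarrow> \<alpha> \<notin> Gamma_b (completion M) n f"
    using D(1) coset by (intro AE_finite_allI)
  \<comment> \<open>Measurability of the set is not established beforehand: it lies in a null set,
    and that already forces its measure to be 0.\<close>
  then have "AE \<alpha> in completion M. \<alpha> \<notin> Gamma_b (completion M) n f"
    by (intro AE_completion) (use D(2) in \<open>auto elim!: eventually_mono\<close>)
  then have "emeasure (completion M) (Gamma_b (completion M) n f) = 0"
    using emeasure_eq_0_AE[of "\<lambda>\<alpha>. \<alpha> \<in> Gamma_b (completion M) n f" "completion M"] by (simp add: space_M)
  then show False using assms(6) by simp
qed

end
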